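(* Let $\mathbb C$ be a semi-abelian category and let $x:X\to A$ and $y:Y\to A$ be subobjects of an object $A$ of $\mathbb C$. Then the following properties are equivalent: (1) $Y$ normalizes $X$. (2) $X$ is a proper subobject of $X\vee Y$, the subobject of $A$ generated by $X$ and $Y$ (i.e. the image of the map $\langle x,y\rangle:X+Y\to A$). (3) The object $X\cap Y$ is proper in $Y$ and the sequence $$0\to X\xrightarrow{\;x'\;}X\vee Y\xrightarrow{\;\overline{q r_Y}\;}Y/(X\cap Y)\to 0$$ is short exact, where $x'$ is the factorization of $x$ through $X\vee Y$, $q:Y\to Y/(X\cap Y)$ is the projection, and $\overline{q r_Y}$ is the map induced on $X\vee Y$ by $q r_Y:X+Y\to Y/(X\cap Y)$ (in particular $q r_Y$ factors through the regular epimorphism $X+Y\to X\vee Y$).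
   Context: Semi-abelian means pointed, finitely complete, finitely cocomplete, protomodular and Barr exact (equivalently, a finitely cocomplete homological category which is Barr exact). A subobject is proper if it is the kernel of some map. For objects $A,G$, $(A|G)$ is the kernel of the canonical map $A+G\to A\times G$, with inclusion $\iota:(A|G)\to A+G$; for $a:A\to A'$, $g:G\to G'$, $(a|g):(A|G)\to(A'|G')$ is the map with $\iota(a|g)=(a+g)\iota$. For an object $A$, $c_2^A=\nabla_A\,\iota_{A,A}:(A|A)\to A$, where $\nabla_A=\langle1,1\rangle:A+A\to A$; this is the conjugation action of $A$ on itself. For subobjects $x:X\to A$, $y:Y\to A$, one says that $Y$ normalizes $X$ if $X$ is $Y$-stable under the conjugation action of $A$ on itself, i.e. if $c_2^A(x|y):(X|Y)\to A$ factors through $x$. The map $r_Y=\langle 0,1\rangle:X+Y\to Y$ is the canonical retraction. *)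

theory Defs
  imports Main
begin

section \<open>Categories\<close>

record ('o, 'm) cat =
  Obj :: "'o set"
  Arr :: "'m set"
  Dom :: "'m \<Rightarrow> 'o"
  Cod :: "'m \<Rightarrow> 'o"
  Ident :: "'o \<Rightarrow> 'm"
  Comp :: "'m \<Rightarrow> 'm \<Rightarrow> 'm"  (infixl "\<cdot>\<index>" 70)

text \<open>\<open>g \<cdot>\<^bsub>C\<^esub> f\<close> is ``first \<open>f\<close>, then \<open>g\<close>''; it is unconstrained when \<open>Cod f \<noteq> Dom g\<close>.\<close>

definition hom :: "('o, 'm) cat \<Rightarrow> 'o \<Rightarrow> 'o \<Rightarrow> 'm set" where
  "hom C A B = {f \<in> Arr C. Dom C f = A \<and> Cod C f = B}"

locale category =
  fixes C :: "('o, 'm) cat" (structure)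
  assumes Dom_in_Obj: "f \<in> Arr C \<Longrightarrow> Dom C f \<in> Obj C"
    and Cod_in_Obj: "f \<in> Arr C \<Longrightarrow> Cod C f \<in> Obj C"
    and Ident_in_hom: "A \<in> Obj C \<Longrightarrow> Ident C A \<in> hom C A A"
    and Comp_in_hom: "f \<in> hom C A B \<Longrightarrow> g \<in> hom C B D \<Longrightarrow> g \<cdot> f \<in> hom C A D"
    and Comp_Ident: "f \<in> hom C A B \<Longrightarrow> f \<cdot> Ident C A = f"
    and Ident_Comp: "f \<in> hom C A B \<Longrightarrow> Ident C B \<cdot> f = f"
    and Comp_assoc: "f \<in> hom C A B \<Longrightarrow> g \<in> hom C B D \<Longrightarrow> h \<in> hom C D E
      \<Longrightarrow> (h \<cdot> g) \<cdot> f = h \<cdot> (g \<cdot> f)"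

definition op_cat :: "('o, 'm) cat \<Rightarrow> ('o, 'm) cat" where
  "op_cat C = \<lparr>Obj = Obj C, Arr = Arr C, Dom = Cod C, Cod = Dom C,
     Ident = Ident C, Comp = (\<lambda>g f. f \<cdot>\<^bsub>C\<^esub> g)\<rparr>"

definition is_monic :: "('o, 'm) cat \<Rightarrow> 'm \<Rightarrow> bool" where
  "is_monic C m \<longleftrightarrow> m \<in> Arr C \<and>
     (\<forall>M. \<forall>g \<in> hom C M (Dom C m). \<forall>h \<in> hom C M (Dom C m).
        m \<cdot>\<^bsub>C\<^esub> g = m \<cdot>\<^bsub>C\<^esub> h \<longrightarrow> g = h)"

definition is_iso :: "('o, 'm) cat \<Rightarrow> 'm \<Rightarrow> bool" where
  "is_iso C f \<longleftrightarrow> f \<in> Arr C \<and>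
     (\<exists>g \<in> hom C (Cod C f) (Dom C f).
        g \<cdot>\<^bsub>C\<^esub> f = Ident C (Dom C f) \<and> f \<cdot>\<^bsub>C\<^esub> g = Ident C (Cod C f))"

section \<open>Finite limits and colimits\<close>

text \<open>A diagram over a finite directed graph, with vertices \<open>I\<close> labelled by the objects \<open>D i\<close> and
  edges \<open>(i, j, f) \<in> E\<close> labelled by arrows \<open>f : D i \<rightarrow> D j\<close>. Parallel edges carrying the same
  label are identified, which does not change the cones.\<close>

definition finite_diagram ::
  "('o, 'm) cat \<Rightarrow> nat set \<Rightarrow> (nat \<Rightarrow> 'o) \<Rightarrow> (nat \<times> nat \<times> 'm) set \<Rightarrow> bool" where
  "finite_diagram C I D E \<longleftrightarrow> finite I \<and> finite E \<and> (\<forall>i \<in> I. D i \<in> Obj C) \<and>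
     (\<forall>(i, j, f) \<in> E. i \<in> I \<and> j \<in> I \<and> f \<in> hom C (D i) (D j))"

definition is_cone ::
  "('o, 'm) cat \<Rightarrow> nat set \<Rightarrow> (nat \<Rightarrow> 'o) \<Rightarrow> (nat \<times> nat \<times> 'm) set \<Rightarrow> 'o \<Rightarrow> (nat \<Rightarrow> 'm) \<Rightarrow> bool" where
  "is_cone C I D E L p \<longleftrightarrow> L \<in> Obj C \<and> (\<forall>i \<in> I. p i \<in> hom C L (D i)) \<and>
     (\<forall>(i, j, f) \<in> E. f \<cdot>\<^bsub>C\<^esub> p i = p j)"

definition is_limit ::
  "('o, 'm) cat \<Rightarrow> nat set \<Rightarrow> (nat \<Rightarrow> 'o) \<Rightarrow> (nat \<times> nat \<times> 'm) set \<Rightarrow> 'o \<Rightarrow> (nat \<Rightarrow> 'm) \<Rightarrow> bool" where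
  "is_limit C I D E L p \<longleftrightarrow> is_cone C I D E L p \<and>
     (\<forall>M q. is_cone C I D E M q \<longrightarrow>
        (\<exists>!u. u \<in> hom C M L \<and> (\<forall>i \<in> I. p i \<cdot>\<^bsub>C\<^esub> u = q i)))"

definition finitely_complete :: "('o, 'm) cat \<Rightarrow> bool" where
  "finitely_complete C \<longleftrightarrow>
     (\<forall>I D E. finite_diagram C I D E \<longrightarrow> (\<exists>L p. is_limit C I D E L p))"

definition finitely_cocomplete :: "('o, 'm) cat \<Rightarrow> bool" where
  "finitely_cocomplete C \<longleftrightarrow> finitely_complete (op_cat C)"

definition is_product :: "('o, 'm) cat \<Rightarrow> 'o \<Rightarrow> 'o \<Rightarrow> 'm \<Rightarrow> 'm \<Rightarrow> bool" where
  "is_product C A B p q \<longleftrightarrow>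
     (\<exists>P. p \<in> hom C P A \<and> q \<in> hom C P B \<and>
       (\<forall>M. \<forall>f \<in> hom C M A. \<forall>g \<in> hom C M B.
          \<exists>!u. u \<in> hom C M P \<and> p \<cdot>\<^bsub>C\<^esub> u = f \<and> q \<cdot>\<^bsub>C\<^esub> u = g))"

definition is_coproduct :: "('o, 'm) cat \<Rightarrow> 'o \<Rightarrow> 'o \<Rightarrow> 'm \<Rightarrow> 'm \<Rightarrow> bool" where
  "is_coproduct C A B i j \<longleftrightarrow>
     (\<exists>S. i \<in> hom C A S \<and> j \<in> hom C B S \<and>
       (\<forall>M. \<forall>f \<in> hom C A M. \<forall>g \<in> hom C B M.
          \<exists>!u. u \<in> hom C S M \<and> u \<cdot>\<^bsub>C\<^esub> i = f \<and> u \<cdot>\<^bsub>C\<^esub> j = g))"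

text \<open>\<open>is_pullback C f g p q\<close>: the square \<open>f \<cdot> p = g \<cdot> q\<close> is a pullback, so \<open>p\<close> is the
  pullback of \<open>g\<close> along \<open>f\<close>, and \<open>q\<close> that of \<open>f\<close> along \<open>g\<close>.\<close>

definition is_pullback :: "('o, 'm) cat \<Rightarrow> 'm \<Rightarrow> 'm \<Rightarrow> 'm \<Rightarrow> 'm \<Rightarrow> bool" where
  "is_pullback C f g p q \<longleftrightarrow>
     f \<in> Arr C \<and> g \<in> Arr C \<and> Cod C f = Cod C g \<and>
     (\<exists>P. p \<in> hom C P (Dom C f) \<and> q \<in> hom C P (Dom C g) \<and> f \<cdot>\<^bsub>C\<^esub> p = g \<cdot>\<^bsub>C\<^esub> q \<and>
       (\<forall>M. \<forall>a \<in> hom C M (Dom C f). \<forall>b \<in> hom C M (Dom C g). f \<cdot>\<^bsub>C\<^esub> a = g \<cdot>\<^bsub>C\<^esub> b \<longrightarrow>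
          (\<exists>!u. u \<in> hom C M P \<and> p \<cdot>\<^bsub>C\<^esub> u = a \<and> q \<cdot>\<^bsub>C\<^esub> u = b)))"

definition is_coequalizer :: "('o, 'm) cat \<Rightarrow> 'm \<Rightarrow> 'm \<Rightarrow> 'm \<Rightarrow> bool" where
  "is_coequalizer C f g e \<longleftrightarrow>
     (\<exists>A B Q. f \<in> hom C A B \<and> g \<in> hom C A B \<and> e \<in> hom C B Q \<and> e \<cdot>\<^bsub>C\<^esub> f = e \<cdot>\<^bsub>C\<^esub> g \<and>
       (\<forall>M. \<forall>h \<in> hom C B M. h \<cdot>\<^bsub>C\<^esub> f = h \<cdot>\<^bsub>C\<^esub> g \<longrightarrow>
          (\<exists>!u. u \<in> hom C Q M \<and> u \<cdot>\<^bsub>C\<^esub> e = h)))"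

definition regular_epi :: "('o, 'm) cat \<Rightarrow> 'm \<Rightarrow> bool" where
  "regular_epi C e \<longleftrightarrow> (\<exists>f g. is_coequalizer C f g e)"

section \<open>Pointed categories\<close>

definition zero_object :: "('o, 'm) cat \<Rightarrow> 'o \<Rightarrow> bool" where
  "zero_object C Z \<longleftrightarrow> Z \<in> Obj C \<and>
     (\<forall>A \<in> Obj C. (\<exists>!f. f \<in> hom C A Z) \<and> (\<exists>!f. f \<in> hom C Z A))"

definition pointed :: "('o, 'm) cat \<Rightarrow> bool" where
  "pointed C \<longleftrightarrow> (\<exists>Z. zero_object C Z)"

definition zero_arr :: "('o, 'm) cat \<Rightarrow> 'o \<Rightarrow> 'o \<Rightarrow> 'm" where
  "zero_arr C A B =
     (THE f. \<exists>Z. zero_object C Z \<and> (\<exists>g \<in> hom C A Z. \<exists>h \<in> hom C Z B. f = h \<cdot>\<^bsub>C\<^esub> g))"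

definition is_kernel :: "('o, 'm) cat \<Rightarrow> 'm \<Rightarrow> 'm \<Rightarrow> bool" where
  "is_kernel C f k \<longleftrightarrow>
     (\<exists>K A B. f \<in> hom C A B \<and> k \<in> hom C K A \<and> f \<cdot>\<^bsub>C\<^esub> k = zero_arr C K B \<and>
       (\<forall>M. \<forall>h \<in> hom C M A. f \<cdot>\<^bsub>C\<^esub> h = zero_arr C M B \<longrightarrow>
          (\<exists>!u. u \<in> hom C M K \<and> k \<cdot>\<^bsub>C\<^esub> u = h)))"

definition is_cokernel :: "('o, 'm) cat \<Rightarrow> 'm \<Rightarrow> 'm \<Rightarrow> bool" where
  "is_cokernel C f q \<longleftrightarrow>
     (\<exists>A B Q. f \<in> hom C A B \<and> q \<in> hom C B Q \<and> q \<cdot>\<^bsub>C\<^esub> f = zero_arr C A Q \<and>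
       (\<forall>M. \<forall>h \<in> hom C B M. h \<cdot>\<^bsub>C\<^esub> f = zero_arr C A M \<longrightarrow>
          (\<exists>!u. u \<in> hom C Q M \<and> u \<cdot>\<^bsub>C\<^esub> q = h)))"

definition is_proper :: "('o, 'm) cat \<Rightarrow> 'm \<Rightarrow> bool" where
  "is_proper C k \<longleftrightarrow> (\<exists>f. is_kernel C f k)"

definition short_exact :: "('o, 'm) cat \<Rightarrow> 'm \<Rightarrow> 'm \<Rightarrow> bool" where
  "short_exact C k f \<longleftrightarrow> is_kernel C f k \<and> is_cokernel C k f"

section \<open>Semi-abelian categories\<close>

text \<open>\<open>p\<close> is a split epimorphism with chosen section \<open>s\<close>: a point over \<open>Cod p\<close>.\<close>

definition is_point :: "('o, 'm) cat \<Rightarrow> 'm \<Rightarrow> 'm \<Rightarrow> bool" where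
  "is_point C p s \<longleftrightarrow> p \<in> Arr C \<and> s \<in> hom C (Cod C p) (Dom C p) \<and>
     p \<cdot>\<^bsub>C\<^esub> s = Ident C (Cod C p)"

text \<open>For every \<open>v : E \<rightarrow> B\<close>, the change-of-base functor from points over \<open>B\<close> to points over \<open>E\<close>
  is conservative. Here \<open>h\<close> is a morphism of points over \<open>B\<close>, \<open>a\<close> and \<open>a'\<close> are the pulled back
  points, and \<open>k\<close> is the image of \<open>h\<close>. The induced sections of \<open>a\<close> and \<open>a'\<close> need not be mentioned,
  since a morphism of points is invertible iff its underlying arrow is.\<close>

definition protomodular :: "('o, 'm) cat \<Rightarrow> bool" where
  "protomodular C \<longleftrightarrow>
     (\<forall>v p s p' s' h a b a' b' k.
        is_point C p s \<and> is_point C p' s' \<and>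
        h \<in> hom C (Dom C p) (Dom C p') \<and> p' \<cdot>\<^bsub>C\<^esub> h = p \<and> h \<cdot>\<^bsub>C\<^esub> s = s' \<and>
        is_pullback C v p a b \<and> is_pullback C v p' a' b' \<and>
        k \<in> hom C (Dom C a) (Dom C a') \<and> a' \<cdot>\<^bsub>C\<^esub> k = a \<and> b' \<cdot>\<^bsub>C\<^esub> k = h \<cdot>\<^bsub>C\<^esub> b \<and>
        is_iso C k \<longrightarrow> is_iso C h)"

definition regular_cat :: "('o, 'm) cat \<Rightarrow> bool" where
  "regular_cat C \<longleftrightarrow> finitely_complete C \<and>
     (\<forall>f p q. is_pullback C f f p q \<longrightarrow> (\<exists>e. is_coequalizer C p q e)) \<and>
     (\<forall>f g p q. is_pullback C f g p q \<and> regular_epi C f \<longrightarrow> regular_epi C q)"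

text \<open>\<open>(r, r')\<close> is an internal equivalence relation \<open>R \<rightrightarrows> A\<close>: jointly monic, reflexive,
  symmetric and transitive.\<close>

definition equivalence_relation :: "('o, 'm) cat \<Rightarrow> 'm \<Rightarrow> 'm \<Rightarrow> bool" where
  "equivalence_relation C r r' \<longleftrightarrow>
     (\<exists>R A. r \<in> hom C R A \<and> r' \<in> hom C R A \<and>
       (\<forall>M. \<forall>g \<in> hom C M R. \<forall>h \<in> hom C M R.
          r \<cdot>\<^bsub>C\<^esub> g = r \<cdot>\<^bsub>C\<^esub> h \<and> r' \<cdot>\<^bsub>C\<^esub> g = r' \<cdot>\<^bsub>C\<^esub> h \<longrightarrow> g = h) \<and>
       (\<exists>d \<in> hom C A R. r \<cdot>\<^bsub>C\<^esub> d = Ident C A \<and> r' \<cdot>\<^bsub>C\<^esub> d = Ident C A) \<and>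
       (\<exists>s \<in> hom C R R. r \<cdot>\<^bsub>C\<^esub> s = r' \<and> r' \<cdot>\<^bsub>C\<^esub> s = r) \<and>
       (\<forall>p q. is_pullback C r' r p q \<longrightarrow>
          (\<exists>t \<in> hom C (Dom C p) R. r \<cdot>\<^bsub>C\<^esub> t = r \<cdot>\<^bsub>C\<^esub> p \<and> r' \<cdot>\<^bsub>C\<^esub> t = r' \<cdot>\<^bsub>C\<^esub> q)))"

definition barr_exact :: "('o, 'm) cat \<Rightarrow> bool" where
  "barr_exact C \<longleftrightarrow> regular_cat C \<and>
     (\<forall>r r'. equivalence_relation C r r' \<longrightarrow> (\<exists>f. is_pullback C f f r r'))"

locale semi_abelian = category C for C :: "('o, 'm) cat" (structure) +
  assumes pointed: "pointed C"
    and finitely_complete: "finitely_complete C"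
    and finitely_cocomplete: "finitely_cocomplete C"
    and protomodular: "protomodular C"
    and barr_exact: "barr_exact C"

section \<open>Chosen universal constructions\<close>

text \<open>In what follows \<open>SOME\<close> fixes one instance of each universal construction, and \<open>THE\<close> names
  the arrow determined by a universal property or by a monomorphism. These are meaningful whenever
  the arrow or construction in question exists.\<close>

definition inl :: "('o, 'm) cat \<Rightarrow> 'o \<Rightarrow> 'o \<Rightarrow> 'm" where
  "inl C A B = fst (SOME (i, j). is_coproduct C A B i j)"

definition inr :: "('o, 'm) cat \<Rightarrow> 'o \<Rightarrow> 'o \<Rightarrow> 'm" where
  "inr C A B = snd (SOME (i, j). is_coproduct C A B i j)"

definition coprod :: "('o, 'm) cat \<Rightarrow> 'o \<Rightarrow> 'o \<Rightarrow> 'o" where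
  "coprod C A B = Cod C (inl C A B)"

definition copair :: "('o, 'm) cat \<Rightarrow> 'm \<Rightarrow> 'm \<Rightarrow> 'm" where
  "copair C f g = (THE u. u \<in> hom C (coprod C (Dom C f) (Dom C g)) (Cod C f) \<and>
     u \<cdot>\<^bsub>C\<^esub> inl C (Dom C f) (Dom C g) = f \<and> u \<cdot>\<^bsub>C\<^esub> inr C (Dom C f) (Dom C g) = g)"

definition coprod_map :: "('o, 'm) cat \<Rightarrow> 'm \<Rightarrow> 'm \<Rightarrow> 'm" where
  "coprod_map C f g = copair C (inl C (Cod C f) (Cod C g) \<cdot>\<^bsub>C\<^esub> f) (inr C (Cod C f) (Cod C g) \<cdot>\<^bsub>C\<^esub> g)"

definition prl :: "('o, 'm) cat \<Rightarrow> 'o \<Rightarrow> 'o \<Rightarrow> 'm" where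
  "prl C A B = fst (SOME (p, q). is_product C A B p q)"

definition prr :: "('o, 'm) cat \<Rightarrow> 'o \<Rightarrow> 'o \<Rightarrow> 'm" where
  "prr C A B = snd (SOME (p, q). is_product C A B p q)"

definition prod_obj :: "('o, 'm) cat \<Rightarrow> 'o \<Rightarrow> 'o \<Rightarrow> 'o" where
  "prod_obj C A B = Dom C (prl C A B)"

definition pair :: "('o, 'm) cat \<Rightarrow> 'm \<Rightarrow> 'm \<Rightarrow> 'm" where
  "pair C f g = (THE u. u \<in> hom C (Dom C f) (prod_obj C (Cod C f) (Cod C g)) \<and>
     prl C (Cod C f) (Cod C g) \<cdot>\<^bsub>C\<^esub> u = f \<and> prr C (Cod C f) (Cod C g) \<cdot>\<^bsub>C\<^esub> u = g)"

definition ker :: "('o, 'm) cat \<Rightarrow> 'm \<Rightarrow> 'm" where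
  "ker C f = (SOME k. is_kernel C f k)"

definition coker :: "('o, 'm) cat \<Rightarrow> 'm \<Rightarrow> 'm" where
  "coker C f = (SOME q. is_cokernel C f q)"

definition factors_through :: "('o, 'm) cat \<Rightarrow> 'm \<Rightarrow> 'm \<Rightarrow> bool" where
  "factors_through C f m \<longleftrightarrow> (\<exists>u \<in> hom C (Dom C f) (Dom C m). m \<cdot>\<^bsub>C\<^esub> u = f)"

definition factorization :: "('o, 'm) cat \<Rightarrow> 'm \<Rightarrow> 'm \<Rightarrow> 'm" where
  "factorization C f m = (THE u. u \<in> hom C (Dom C f) (Dom C m) \<and> m \<cdot>\<^bsub>C\<^esub> u = f)"

section \<open>Normalization\<close>

definition coprod_to_prod :: "('o, 'm) cat \<Rightarrow> 'o \<Rightarrow> 'o \<Rightarrow> 'm" where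
  "coprod_to_prod C A G = pair C
     (copair C (Ident C A) (zero_arr C G A))
     (copair C (zero_arr C A G) (Ident C G))"

text \<open>The inclusion \<open>\<iota> : (A|G) \<rightarrow> A + G\<close>; the object \<open>(A|G)\<close> is its domain.\<close>

definition cosmash_incl :: "('o, 'm) cat \<Rightarrow> 'o \<Rightarrow> 'o \<Rightarrow> 'm" where
  "cosmash_incl C A G = ker C (coprod_to_prod C A G)"

definition cosmash_map :: "('o, 'm) cat \<Rightarrow> 'm \<Rightarrow> 'm \<Rightarrow> 'm" where
  "cosmash_map C a g = factorization C
     (coprod_map C a g \<cdot>\<^bsub>C\<^esub> cosmash_incl C (Dom C a) (Dom C g))
     (cosmash_incl C (Cod C a) (Cod C g))"

definition conj_action :: "('o, 'm) cat \<Rightarrow> 'o \<Rightarrow> 'm" where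
  "conj_action C A = copair C (Ident C A) (Ident C A) \<cdot>\<^bsub>C\<^esub> cosmash_incl C A A"

definition is_subobject :: "('o, 'm) cat \<Rightarrow> 'm \<Rightarrow> 'o \<Rightarrow> 'o \<Rightarrow> bool" where
  "is_subobject C x X A \<longleftrightarrow> x \<in> hom C X A \<and> is_monic C x"

text \<open>\<open>Y\<close> normalizes \<open>X\<close>, where \<open>x : X \<rightarrow> A\<close> and \<open>y : Y \<rightarrow> A\<close> (note the order of arguments).\<close>

definition normalizes :: "('o, 'm) cat \<Rightarrow> 'm \<Rightarrow> 'm \<Rightarrow> bool" where
  "normalizes C y x \<longleftrightarrow> factors_through C (conj_action C (Cod C x) \<cdot>\<^bsub>C\<^esub> cosmash_map C x y) x"

section \<open>Joins and intersections of subobjects\<close>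

definition is_image_factorization :: "('o, 'm) cat \<Rightarrow> 'm \<Rightarrow> 'm \<Rightarrow> 'm \<Rightarrow> bool" where
  "is_image_factorization C f e m \<longleftrightarrow>
     regular_epi C e \<and> is_monic C m \<and> Cod C e = Dom C m \<and> m \<cdot>\<^bsub>C\<^esub> e = f"

text \<open>The regular epimorphism \<open>X + Y \<rightarrow> X \<or> Y\<close> and the inclusion \<open>X \<or> Y \<rightarrow> A\<close>.\<close>

definition join_epi :: "('o, 'm) cat \<Rightarrow> 'm \<Rightarrow> 'm \<Rightarrow> 'm" where
  "join_epi C x y = fst (SOME (e, m). is_image_factorization C (copair C x y) e m)"

definition join_incl :: "('o, 'm) cat \<Rightarrow> 'm \<Rightarrow> 'm \<Rightarrow> 'm" where
  "join_incl C x y = snd (SOME (e, m). is_image_factorization C (copair C x y) e m)"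

definition join_obj :: "('o, 'm) cat \<Rightarrow> 'm \<Rightarrow> 'm \<Rightarrow> 'o" where
  "join_obj C x y = Dom C (join_incl C x y)"

text \<open>The inclusion \<open>X \<inter> Y \<rightarrow> Y\<close>.\<close>

definition meet_incl :: "('o, 'm) cat \<Rightarrow> 'm \<Rightarrow> 'm \<Rightarrow> 'm" where
  "meet_incl C x y = snd (SOME (p, q). is_pullback C x y p q)"

text \<open>The projection \<open>Y \<rightarrow> Y/(X \<inter> Y)\<close>.\<close>

definition quot_proj :: "('o, 'm) cat \<Rightarrow> 'm \<Rightarrow> 'm \<Rightarrow> 'm" where
  "quot_proj C x y = coker C (meet_incl C x y)"

text \<open>The retraction \<open>r\<^sub>Y = \<langle>0, 1\<rangle> : X + Y \<rightarrow> Y\<close>.\<close>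

definition retr :: "('o, 'm) cat \<Rightarrow> 'o \<Rightarrow> 'o \<Rightarrow> 'm" where
  "retr C X Y = copair C (zero_arr C X Y) (Ident C Y)"

end

theory Submission
  imports Defs
begin

text \<open>Let \<open>k\<close> be the kernel of \<open>r\<^sub>Y : X + Y \<rightarrow> Y\<close>. By protomodularity the domain of \<open>k\<close> is generated by
  \<open>X\<close> and \<open>(X|Y)\<close>, so \<open>Y\<close> normalizes \<open>X\<close> iff \<open>\<langle>x, y\<rangle> \<cdot> k\<close> factors through \<open>x\<close>, that is, iff \<open>X\<close> is the
  image of \<open>k\<close> under the regular epimorphism \<open>e : X + Y \<rightarrow> X \<or> Y\<close>. By exactness such an image is
  proper. If \<open>X\<close> is proper in \<open>X \<or> Y\<close> with quotient map \<open>f\<close>, then \<open>f \<cdot> e = (f \<cdot> y') \<cdot> r\<^sub>Y\<close>, where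
  \<open>f \<cdot> y'\<close> is a cokernel of \<open>X \<inter> Y \<rightarrow> Y\<close>, and this gives the short exact sequence.\<close>

section \<open>Categories with finite limits\<close>

text \<open>Two devices replace computation with elements. Protomodularity is used through one
  principle: an arrow out of the domain of a split epimorphism factors through a monomorphism as
  soon as it does so on the kernel and on the section (\<open>factors_through_split\<close>).
  Arguments that multiply or divide elements in groups are arranged so that a suitable arrow is
  split and its kernel is understood. Choices of preimages are made after pulling back along a
  regular epimorphism, and conclusions descend because a factorization through a monomorphism can be
  tested on such a cover. Effectiveness of equivalence relations is used once: the image of a kernel
  is at first only a subobject, and an arrow having it as kernel must be produced as a quotient.
  Condition (3) prescribes the map \<open>q\<close>, whereas (2) offers some arrow with the right
  kernel; the gap is closed by comparing cokernels, which requires that a regular epimorphism be the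
  cokernel of its kernel.\<close>

lemma hom_iff [simp]: "f \<in> hom C A B \<longleftrightarrow> f \<in> Arr C \<and> Dom C f = A \<and> Cod C f = B"
  by (simp add: hom_def)

context category
begin

section \<open>Typed composition\<close>

lemma Ident_simps [simp]:
  assumes "A \<in> Obj C"
  shows "Ident C A \<in> Arr C" "Dom C (Ident C A) = A" "Cod C (Ident C A) = A"
  using Ident_in_hom[OF assms] by simp_all

lemma Comp_simps [simp]:
  assumes "f \<in> Arr C" "g \<in> Arr C" "Cod C f = Dom C g"
  shows "g \<cdot> f \<in> Arr C" "Dom C (g \<cdot> f) = Dom C f" "Cod C (g \<cdot> f) = Cod C g"
  using Comp_in_hom[of f "Dom C f" "Cod C f" g "Cod C g"] assms by simp_all

lemma Comp_Ident_simp [simp]: "f \<in> Arr C \<Longrightarrow> Dom C f = A \<Longrightarrow> f \<cdot> Ident C A = f"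
  using Comp_Ident[of f A "Cod C f"] by simp

lemma Ident_Comp_simp [simp]: "f \<in> Arr C \<Longrightarrow> Cod C f = A \<Longrightarrow> Ident C A \<cdot> f = f"
  using Ident_Comp[of f "Dom C f" A] by simp

lemma assoc [simp]:
  assumes "f \<in> Arr C" "g \<in> Arr C" "h \<in> Arr C" "Cod C f = Dom C g" "Cod C g = Dom C h"
  shows "(h \<cdot> g) \<cdot> f = h \<cdot> (g \<cdot> f)"
  using Comp_assoc[of f "Dom C f" "Cod C f" g "Cod C g" h "Cod C h"] assms by simp

text \<open>The rule \<open>assoc\<close> nests composites to the right, which hides the redex
  \<open>g \<cdot> f\<close> inside \<open>g \<cdot> (f \<cdot> k)\<close>. This form applies an
  equation between composites there.\<close>

lemma reassoc:
  assumes "g \<cdot> f = h" "f \<in> Arr C" "g \<in> Arr C" "Cod C f = Dom C g" "k \<in> Arr C" "Cod C k = Dom C f"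
  shows "g \<cdot> (f \<cdot> k) = h \<cdot> k"
  using assoc[of k f g] assms by simp

section \<open>Monomorphisms and pullbacks\<close>

lemma monicD:
  assumes "is_monic C m" "m \<cdot> g = m \<cdot> h" "g \<in> Arr C" "h \<in> Arr C"
    "Dom C g = Dom C h" "Cod C g = Dom C m" "Cod C h = Dom C m"
  shows "g = h"
proof -
  have "g \<in> hom C (Dom C h) (Dom C m)" "h \<in> hom C (Dom C h) (Dom C m)" using assms by simp_all
  with assms(1,2) show ?thesis unfolding is_monic_def by blast
qed

lemma is_monicI:
  assumes "m \<in> Arr C"
    and "\<And>g h. g \<in> Arr C \<Longrightarrow> h \<in> Arr C \<Longrightarrow> Dom C g = Dom C h \<Longrightarrow> Cod C g = Dom C m
      \<Longrightarrow> Cod C h = Dom C m \<Longrightarrow> m \<cdot> g = m \<cdot> h \<Longrightarrow> g = h"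
  shows "is_monic C m"
  using assms unfolding is_monic_def by simp

lemma monic_factor:
  assumes "is_monic C (m \<cdot> g)" "m \<in> Arr C" "g \<in> Arr C" "Cod C g = Dom C m"
  shows "is_monic C g"
proof (rule is_monicI)
  fix u v assume "u \<in> Arr C" "v \<in> Arr C" "Dom C u = Dom C v" "Cod C u = Dom C g" "Cod C v = Dom C g"
    "g \<cdot> u = g \<cdot> v"
  then show "u = v" using assms by - (rule monicD[OF assms(1)], auto)
qed fact

lemma pullbackD:
  assumes "is_pullback C f g p q"
  shows "f \<in> Arr C" "g \<in> Arr C" "p \<in> Arr C" "q \<in> Arr C" "Cod C g = Cod C f"
    "Cod C p = Dom C f" "Cod C q = Dom C g" "Dom C q = Dom C p" "f \<cdot> p = g \<cdot> q"
  using assms unfolding is_pullback_def by auto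

lemma pullback_lift:
  assumes "is_pullback C f g p q" "f \<cdot> a = g \<cdot> b" "a \<in> Arr C" "b \<in> Arr C"
    "Cod C a = Dom C f" "Cod C b = Dom C g" "Dom C b = Dom C a"
  obtains u where "u \<in> Arr C" "Dom C u = Dom C a" "Cod C u = Dom C p" "p \<cdot> u = a" "q \<cdot> u = b"
proof -
  have "a \<in> hom C (Dom C a) (Dom C f)" "b \<in> hom C (Dom C a) (Dom C g)" using assms by simp_all
  with assms(1,2) obtain u where "u \<in> hom C (Dom C a) (Dom C p) \<and> p \<cdot> u = a \<and> q \<cdot> u = b"
    unfolding is_pullback_def by (metis hom_iff)
  then show thesis by (intro that[of u]) simp_all
qed

lemma pullback_joint_monic:
  assumes "is_pullback C f g p q" "p \<cdot> u = p \<cdot> v" "q \<cdot> u = q \<cdot> v" "u \<in> Arr C" "v \<in> Arr C"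
    "Dom C u = Dom C v" "Cod C u = Dom C p" "Cod C v = Dom C p"
  shows "u = v"
proof -
  note P = pullbackD[OF assms(1)]
  have "p \<cdot> v \<in> hom C (Dom C v) (Dom C f)" "q \<cdot> v \<in> hom C (Dom C v) (Dom C g)"
    "f \<cdot> (p \<cdot> v) = g \<cdot> (q \<cdot> v)"
    using P assms(4-) reassoc[OF P(9), of v] by simp_all
  then have "\<exists>!w. w \<in> hom C (Dom C v) (Dom C p) \<and> p \<cdot> w = p \<cdot> v \<and> q \<cdot> w = q \<cdot> v"
    using assms(1) unfolding is_pullback_def by (metis hom_iff)
  then show ?thesis using assms by (metis hom_iff)
qed

lemma pullback_monic:
  assumes pb: "is_pullback C f g p q" and m: "is_monic C g"
  shows "is_monic C p"
proof (rule is_monicI)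
  note P = pullbackD[OF pb]
  show "p \<in> Arr C" by (fact P)
  fix u v assume uv: "u \<in> Arr C" "v \<in> Arr C" "Dom C u = Dom C v" "Cod C u = Dom C p" "Cod C v = Dom C p"
    "p \<cdot> u = p \<cdot> v"
  have "g \<cdot> (q \<cdot> u) = f \<cdot> (p \<cdot> u)" using P uv(1-5) reassoc[OF P(9), of u] by simp
  also have "\<dots> = g \<cdot> (q \<cdot> v)" using P uv reassoc[OF P(9), of v] by simp
  finally have "q \<cdot> u = q \<cdot> v" using P uv(1-5) by - (rule monicD[OF m], auto)
  then show "u = v" using pullback_joint_monic[OF pb] uv by blast
qed

section \<open>Pullbacks, products and coproducts from finite (co)limits\<close>

lemma pullback_exists:
  assumes fc: "finitely_complete C" and f: "f \<in> Arr C" "g \<in> Arr C" "Cod C g = Cod C f"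
  obtains p q where "is_pullback C f g p q"
proof -
  define D where "D = (\<lambda>i::nat. if i = 0 then Dom C f else if i = 1 then Dom C g else Cod C f)"
  define E where "E = {(0::nat, 2::nat, f), (1, 2, g)}"
  have "finite_diagram C {0,1,2} D E"
    unfolding finite_diagram_def D_def E_def using f by (auto simp: Dom_in_Obj Cod_in_Obj)
  then obtain L pr where L: "is_limit C {0,1,2} D E L pr"
    using fc unfolding finitely_complete_def by blast
  then have cone: "pr 0 \<in> hom C L (Dom C f)" "pr 1 \<in> hom C L (Dom C g)"
      "f \<cdot> pr 0 = pr 2" "g \<cdot> pr 1 = pr 2"
    unfolding is_limit_def is_cone_def D_def E_def by auto
  have "\<exists>!u. u \<in> hom C M L \<and> pr 0 \<cdot> u = a \<and> pr 1 \<cdot> u = b"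
    if ab: "a \<in> hom C M (Dom C f)" "b \<in> hom C M (Dom C g)" "f \<cdot> a = g \<cdot> b" for M a b
  proof -
    define r where "r = (\<lambda>i::nat. if i = 0 then a else if i = 1 then b else f \<cdot> a)"
    have "is_cone C {0,1,2} D E M r"
      unfolding is_cone_def D_def E_def r_def using ab f by (auto simp: Dom_in_Obj)
    then have *: "\<exists>!u. u \<in> hom C M L \<and> (\<forall>i \<in> {0,1,2}. pr i \<cdot> u = r i)"
      using L unfolding is_limit_def by blast
    \<comment> \<open>The leg to the corner of the cospan is determined by the leg to
      \<open>Dom C f\<close>, so the limit condition at vertex 2 may be dropped.\<close>
    have "pr 2 \<cdot> u = f \<cdot> a" if "u \<in> hom C M L" "pr 0 \<cdot> u = a" for u
      using that cone f reassoc[OF cone(3), of u] by auto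
    then have "(u \<in> hom C M L \<and> (\<forall>i \<in> {0,1,2}. pr i \<cdot> u = r i)) \<longleftrightarrow>
        (u \<in> hom C M L \<and> pr 0 \<cdot> u = a \<and> pr 1 \<cdot> u = b)" for u
      unfolding r_def by auto
    with * show ?thesis by simp
  qed
  moreover have "f \<cdot> pr 0 = g \<cdot> pr 1" using cone by simp
  ultimately have "is_pullback C f g (pr 0) (pr 1)"
    unfolding is_pullback_def using cone(1,2) f by metis
  then show thesis by (rule that)
qed

lemma product_exists:
  assumes fc: "finitely_complete C" and AB: "A \<in> Obj C" "B \<in> Obj C"
  obtains p q where "is_product C A B p q"
proof -
  define D where "D = (\<lambda>i::nat. if i = 0 then A else B)"
  have "finite_diagram C {0,1} D {}"
    unfolding finite_diagram_def D_def using AB by auto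
  then obtain L pr where L: "is_limit C {0,1} D {} L pr"
    using fc unfolding finitely_complete_def by blast
  then have cone: "pr 0 \<in> hom C L A" "pr 1 \<in> hom C L B"
    unfolding is_limit_def is_cone_def D_def by auto
  have "\<exists>!u. u \<in> hom C M L \<and> pr 0 \<cdot> u = a \<and> pr 1 \<cdot> u = b"
    if ab: "a \<in> hom C M A" "b \<in> hom C M B" for M a b
  proof -
    define r where "r = (\<lambda>i::nat. if i = 0 then a else b)"
    have "is_cone C {0,1} D {} M r"
      unfolding is_cone_def D_def r_def using ab Dom_in_Obj[of a] by auto
    then have "\<exists>!u. u \<in> hom C M L \<and> (\<forall>i \<in> {0,1}. pr i \<cdot> u = r i)"
      using L unfolding is_limit_def by blast
    then show ?thesis unfolding r_def by simp
  qed
  then have "is_product C A B (pr 0) (pr 1)"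
    unfolding is_product_def using cone by blast
  then show thesis by (rule that)
qed

lemma hom_op_cat: "hom (op_cat C) A B = hom C B A"
  by (auto simp: hom_def op_cat_def)

lemma category_op_cat: "category (op_cat C)"
  by unfold_locales (auto simp: op_cat_def Dom_in_Obj Cod_in_Obj)

lemma coproduct_exists:
  assumes "finitely_cocomplete C" "A \<in> Obj C" "B \<in> Obj C"
  obtains i j where "is_coproduct C A B i j"
proof -
  obtain p q where "is_product (op_cat C) A B p q"
    using category.product_exists[OF category_op_cat, of A B] assms
    unfolding finitely_cocomplete_def by (auto simp: op_cat_def)
  then have "is_coproduct C A B p q"
    unfolding is_product_def is_coproduct_def hom_op_cat by (simp add: op_cat_def)
  then show thesis by (rule that)
qed

section \<open>Regular epimorphisms and descent of factorizations\<close>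

lemma regular_epiD:
  assumes "regular_epi C e"
  obtains s t where "e \<in> Arr C" "s \<in> Arr C" "t \<in> Arr C" "Dom C t = Dom C s"
    "Cod C s = Dom C e" "Cod C t = Dom C e" "e \<cdot> s = e \<cdot> t"
    "\<And>h. h \<in> Arr C \<Longrightarrow> Dom C h = Dom C e \<Longrightarrow> h \<cdot> s = h \<cdot> t \<Longrightarrow>
      \<exists>!u. u \<in> hom C (Cod C e) (Cod C h) \<and> u \<cdot> e = h"
proof -
  obtain s t where "is_coequalizer C s t e" using assms unfolding regular_epi_def by blast
  then obtain A B Q where "s \<in> hom C A B" "t \<in> hom C A B" "e \<in> hom C B Q" "e \<cdot> s = e \<cdot> t"
    and *: "\<And>M h. h \<in> hom C B M \<Longrightarrow> h \<cdot> s = h \<cdot> t \<Longrightarrow> \<exists>!u. u \<in> hom C Q M \<and> u \<cdot> e = h"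
    unfolding is_coequalizer_def by blast
  then show thesis using that[of s t] by auto
qed

lemma regular_epi_in_Arr: "regular_epi C e \<Longrightarrow> e \<in> Arr C"
  by (erule regular_epiD)

lemma regular_epi_cancel:
  assumes "regular_epi C e" "u \<cdot> e = v \<cdot> e" "u \<in> Arr C" "v \<in> Arr C"
    "Dom C u = Cod C e" "Dom C v = Cod C e"
  shows "u = v"
  using assms(1)
proof (rule regular_epiD)
  fix s t assume st: "e \<in> Arr C" "s \<in> Arr C" "t \<in> Arr C" "Dom C t = Dom C s"
    "Cod C s = Dom C e" "Cod C t = Dom C e" and eq: "e \<cdot> s = e \<cdot> t"
    and U: "\<And>h. h \<in> Arr C \<Longrightarrow> Dom C h = Dom C e \<Longrightarrow> h \<cdot> s = h \<cdot> t \<Longrightarrow>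
      \<exists>!u. u \<in> hom C (Cod C e) (Cod C h) \<and> u \<cdot> e = h"
  have "(u \<cdot> e) \<cdot> s = (u \<cdot> e) \<cdot> t" using st eq assms(3-) by simp
  then have "\<exists>!w. w \<in> hom C (Cod C e) (Cod C (u \<cdot> e)) \<and> w \<cdot> e = u \<cdot> e"
    using assms st by (intro U) auto
  moreover have "Cod C (u \<cdot> e) = Cod C u" "Cod C (v \<cdot> e) = Cod C v"
    using assms(3-) st by simp_all
  ultimately show ?thesis using assms by (metis hom_iff)
qed

text \<open>The arrow \<open>p\<close> is the coequalizer of \<open>s \<cdot> p\<close> and the
  identity: an arrow \<open>h\<close> with \<open>h \<cdot> s \<cdot> p = h\<close> descends to
  \<open>h \<cdot> s\<close>.\<close>

lemma split_epi_regular: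
  assumes "p \<in> hom C A B" "s \<in> hom C B A" "p \<cdot> s = Ident C B"
  shows "regular_epi C p"
  unfolding regular_epi_def is_coequalizer_def
proof (intro exI conjI allI ballI impI)
  have obj: "A \<in> Obj C" "B \<in> Obj C" using assms Dom_in_Obj[of p] Cod_in_Obj[of p] by auto
  show "s \<cdot> p \<in> hom C A A" "Ident C A \<in> hom C A A" "p \<in> hom C A B" using assms obj by auto
  show "p \<cdot> (s \<cdot> p) = p \<cdot> Ident C A" using assms reassoc[OF assms(3), of p] by simp
  fix M h assume h: "h \<in> hom C A M" "h \<cdot> (s \<cdot> p) = h \<cdot> Ident C A"
  show "\<exists>!u. u \<in> hom C B M \<and> u \<cdot> p = h"
  proof (rule ex1I[of _ "h \<cdot> s"])
    show "h \<cdot> s \<in> hom C B M \<and> (h \<cdot> s) \<cdot> p = h" using assms h by simp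
    fix u assume "u \<in> hom C B M \<and> u \<cdot> p = h"
    then show "u = h \<cdot> s" using assms by auto
  qed
qed

lemma factors_throughI:
  assumes "m \<cdot> u = f" "u \<in> Arr C" "m \<in> Arr C" "Cod C u = Dom C m"
  shows "factors_through C f m"
  using assms unfolding factors_through_def by auto

lemma factors_throughE:
  assumes "factors_through C f m"
  obtains u where "u \<in> Arr C" "Dom C u = Dom C f" "Cod C u = Dom C m" "m \<cdot> u = f"
  using assms unfolding factors_through_def by auto

lemma factors_through_comp:
  assumes "factors_through C f m" "m \<in> Arr C" "g \<in> Arr C" "Cod C g = Dom C f"
  shows "factors_through C (f \<cdot> g) m"
  using assms(1)
proof (rule factors_throughE)
  fix u assume "u \<in> Arr C" "Dom C u = Dom C f" "Cod C u = Dom C m" "m \<cdot> u = f"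
  then show ?thesis using assms by (intro factors_throughI[of m "u \<cdot> g"]) auto
qed

text \<open>Regular epimorphisms act as covers. The factor of \<open>b \<cdot> c\<close> through
  \<open>m\<close> identifies the pair coequalized by \<open>c\<close>, since \<open>m\<close> is
  monic, and therefore descends along \<open>c\<close>.\<close>

lemma factors_through_local:
  assumes m: "is_monic C m" and c: "regular_epi C c"
    and b: "b \<in> Arr C" "Dom C b = Cod C c" and bc: "factors_through C (b \<cdot> c) m" and cod: "Cod C m = Cod C b"
  shows "factors_through C b m"
  using c
proof (rule regular_epiD)
  fix s t assume st: "c \<in> Arr C" "s \<in> Arr C" "t \<in> Arr C" "Dom C t = Dom C s"
    "Cod C s = Dom C c" "Cod C t = Dom C c" and eq: "c \<cdot> s = c \<cdot> t"
    and U: "\<And>h. h \<in> Arr C \<Longrightarrow> Dom C h = Dom C c \<Longrightarrow> h \<cdot> s = h \<cdot> t \<Longrightarrow>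
      \<exists>!u. u \<in> hom C (Cod C c) (Cod C h) \<and> u \<cdot> c = h"
  have mA: "m \<in> Arr C" using m by (simp add: is_monic_def)
  obtain u where u: "u \<in> Arr C" "Dom C u = Dom C (b \<cdot> c)" "Cod C u = Dom C m" and mu: "m \<cdot> u = b \<cdot> c"
    using bc by (rule factors_throughE)
  have uD: "Dom C u = Dom C c" using u b st by simp
  have "m \<cdot> (u \<cdot> s) = m \<cdot> (u \<cdot> t)"
    using reassoc[OF mu, of s] reassoc[OF mu, of t] eq st b u(1,3) uD mA by simp
  then have "u \<cdot> s = u \<cdot> t" using st u(1,3) uD mA by - (rule monicD[OF m], auto)
  then obtain w where w: "w \<in> hom C (Cod C c) (Dom C m)" "w \<cdot> c = u" using U[of u] u(1,3) uD by auto
  have "(m \<cdot> w) \<cdot> c = b \<cdot> c" using w mu st mA by simp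
  then have "m \<cdot> w = b" using w mA b st by - (rule regular_epi_cancel[OF c], auto)
  then show ?thesis using w mA by (intro factors_throughI[of m w]) auto
qed

end

section \<open>Pointed protomodular categories\<close>

context semi_abelian
begin

declare Dom_in_Obj [simp] Cod_in_Obj [simp]

section \<open>Zero objects and zero arrows\<close>

lemma zero_object_exists:
  obtains Z where "zero_object C Z" "Z \<in> Obj C"
  using pointed unfolding pointed_def zero_object_def by blast

lemma zero_objectD:
  assumes "zero_object C Z" "A \<in> Obj C"
  shows "\<exists>!f. f \<in> hom C A Z" "\<exists>!f. f \<in> hom C Z A"
proof -
  have "(\<exists>!f. f \<in> hom C A Z) \<and> (\<exists>!f. f \<in> hom C Z A)"
    using assms unfolding zero_object_def by (elim conjE bspec)
  from conjunct1[OF this] conjunct2[OF this]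
  show "\<exists>!f. f \<in> hom C A Z" "\<exists>!f. f \<in> hom C Z A" .
qed

lemma zero_object_terminal:
  assumes "zero_object C Z" "f \<in> Arr C" "g \<in> Arr C" "Dom C f = Dom C g" "Cod C f = Z" "Cod C g = Z"
  shows "f = g"
proof -
  have "f \<in> hom C (Dom C g) Z" "g \<in> hom C (Dom C g) Z" using assms by simp_all
  then show ?thesis using zero_objectD(1)[OF assms(1) Dom_in_Obj[OF assms(3)]] by (elim ex1E) metis
qed

lemma zero_object_initial:
  assumes "zero_object C Z" "f \<in> Arr C" "g \<in> Arr C" "Cod C f = Cod C g" "Dom C f = Z" "Dom C g = Z"
  shows "f = g"
proof -
  have "f \<in> hom C Z (Cod C g)" "g \<in> hom C Z (Cod C g)" using assms by simp_all
  then show ?thesis using zero_objectD(2)[OF assms(1) Cod_in_Obj[OF assms(3)]] by (elim ex1E) metis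
qed

text \<open>The \<open>THE\<close> in \<open>zero_arr\<close> ranges over composites through all
  zero objects. They agree because any arrow \<open>t\<close> between two zero objects carries one
  composite to the other.\<close>

lemma zero_arr_eq:
  assumes Z: "zero_object C Z" and gh: "g \<in> hom C A Z" "h \<in> hom C Z B"
  shows "zero_arr C A B = h \<cdot> g"
  unfolding zero_arr_def
proof (rule the_equality)
  fix f assume "\<exists>Z'. zero_object C Z' \<and> (\<exists>g'\<in>hom C A Z'. \<exists>h'\<in>hom C Z' B. f = h' \<cdot> g')"
  then obtain Z' g' h' where Z': "zero_object C Z'" "g' \<in> hom C A Z'" "h' \<in> hom C Z' B" "f = h' \<cdot> g'"
    by blast
  have "Z \<in> Obj C" using Z unfolding zero_object_def by (rule conjunct1)
  then obtain t where t: "t \<in> hom C Z Z'"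
    using ex1_implies_ex[OF zero_objectD(1)[OF Z'(1)]] by blast
  have "t \<cdot> g = g'" using t gh Z' by - (rule zero_object_terminal[OF Z'(1)], auto)
  moreover have "h' \<cdot> t = h" using t gh Z' by - (rule zero_object_initial[OF Z], auto)
  then have "h' \<cdot> (t \<cdot> g) = h \<cdot> g" using t gh Z' reassoc[of h' t h g] by auto
  ultimately show "f = h \<cdot> g" using Z'(4) by simp
qed (use assms in blast)

lemma zero_arr_factor:
  assumes "A \<in> Obj C" "B \<in> Obj C"
  obtains Z g h where "zero_object C Z" "g \<in> hom C A Z" "h \<in> hom C Z B" "zero_arr C A B = h \<cdot> g"
proof -
  obtain Z where Z: "zero_object C Z" "Z \<in> Obj C" by (rule zero_object_exists)
  obtain g where g: "g \<in> hom C A Z" using ex1_implies_ex[OF zero_objectD(1)[OF Z(1) assms(1)]] by blast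
  obtain h where h: "h \<in> hom C Z B" using ex1_implies_ex[OF zero_objectD(2)[OF Z(1) assms(2)]] by blast
  show thesis using that Z(1) g h zero_arr_eq[OF Z(1) g h] by metis
qed

lemma zero_arr_simps [simp]:
  assumes "A \<in> Obj C" "B \<in> Obj C"
  shows "zero_arr C A B \<in> Arr C" "Dom C (zero_arr C A B) = A" "Cod C (zero_arr C A B) = B"
  using assms by (rule zero_arr_factor, simp)+

lemma zero_arr_comp [simp]:
  assumes "f \<in> Arr C" "Cod C f = A" "B \<in> Obj C"
  shows "zero_arr C A B \<cdot> f = zero_arr C (Dom C f) B"
proof -
  have "A \<in> Obj C" using assms by auto
  then obtain Z g h where Z: "zero_object C Z" "g \<in> hom C A Z" "h \<in> hom C Z B" "zero_arr C A B = h \<cdot> g"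
    using assms zero_arr_factor by metis
  then have "zero_arr C (Dom C f) B = h \<cdot> (g \<cdot> f)" using assms by (intro zero_arr_eq[OF Z(1)]) auto
  then show ?thesis using Z assms by simp
qed

lemma comp_zero_arr [simp]:
  assumes "f \<in> Arr C" "Dom C f = B" "A \<in> Obj C"
  shows "f \<cdot> zero_arr C A B = zero_arr C A (Cod C f)"
proof -
  have "B \<in> Obj C" using assms by auto
  then obtain Z g h where Z: "zero_object C Z" "g \<in> hom C A Z" "h \<in> hom C Z B" "zero_arr C A B = h \<cdot> g"
    using assms zero_arr_factor by metis
  then have "zero_arr C A (Cod C f) = (f \<cdot> h) \<cdot> g" using assms by (intro zero_arr_eq[OF Z(1)]) auto
  then show ?thesis using Z assms by simp
qed

section \<open>Chosen products and coproducts\<close>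

lemma chosen_product:
  assumes "A \<in> Obj C" "B \<in> Obj C"
  shows "is_product C A B (prl C A B) (prr C A B)"
proof -
  obtain p q where "is_product C A B p q" using product_exists[OF finitely_complete assms] .
  then have "case (SOME (i, j). is_product C A B i j) of (i, j) \<Rightarrow> is_product C A B i j"
    by (intro someI[of "\<lambda>(i, j). is_product C A B i j" "(p, q)"]) simp
  then show ?thesis unfolding prl_def prr_def by (simp add: case_prod_beta)
qed

lemma chosen_coproduct:
  assumes "A \<in> Obj C" "B \<in> Obj C"
  shows "is_coproduct C A B (inl C A B) (inr C A B)"
proof -
  obtain p q where "is_coproduct C A B p q" using coproduct_exists[OF finitely_cocomplete assms] .
  then have "case (SOME (i, j). is_coproduct C A B i j) of (i, j) \<Rightarrow> is_coproduct C A B i j"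
    by (intro someI[of "\<lambda>(i, j). is_coproduct C A B i j" "(p, q)"]) simp
  then show ?thesis unfolding inl_def inr_def by (simp add: case_prod_beta)
qed

lemma pr_simps [simp]:
  assumes "A \<in> Obj C" "B \<in> Obj C"
  shows "prl C A B \<in> Arr C" "Dom C (prl C A B) = prod_obj C A B" "Cod C (prl C A B) = A"
    "prr C A B \<in> Arr C" "Dom C (prr C A B) = prod_obj C A B" "Cod C (prr C A B) = B"
    "prod_obj C A B \<in> Obj C"
  using chosen_product[OF assms] unfolding is_product_def prod_obj_def by auto

lemma in_simps [simp]:
  assumes "A \<in> Obj C" "B \<in> Obj C"
  shows "inl C A B \<in> Arr C" "Dom C (inl C A B) = A" "Cod C (inl C A B) = coprod C A B"
    "inr C A B \<in> Arr C" "Dom C (inr C A B) = B" "Cod C (inr C A B) = coprod C A B"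
    "coprod C A B \<in> Obj C"
  using chosen_coproduct[OF assms] unfolding is_coproduct_def coprod_def by auto

lemma product_ex1:
  assumes AB: "A \<in> Obj C" "B \<in> Obj C" and fg: "f \<in> hom C M A" "g \<in> hom C M B"
  shows "\<exists>!u. u \<in> hom C M (prod_obj C A B) \<and> prl C A B \<cdot> u = f \<and> prr C A B \<cdot> u = g"
proof -
  obtain P where "prl C A B \<in> hom C P A"
    and U: "\<And>M f g. f \<in> hom C M A \<Longrightarrow> g \<in> hom C M B
      \<Longrightarrow> \<exists>!u. u \<in> hom C M P \<and> prl C A B \<cdot> u = f \<and> prr C A B \<cdot> u = g"
    using chosen_product[OF AB] unfolding is_product_def by blast
  then have "P = prod_obj C A B" unfolding prod_obj_def by simp
  with U[OF fg] show ?thesis by simp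
qed

lemma coproduct_ex1:
  assumes AB: "A \<in> Obj C" "B \<in> Obj C" and fg: "f \<in> hom C A M" "g \<in> hom C B M"
  shows "\<exists>!u. u \<in> hom C (coprod C A B) M \<and> u \<cdot> inl C A B = f \<and> u \<cdot> inr C A B = g"
proof -
  obtain S where "inl C A B \<in> hom C A S"
    and U: "\<And>M f g. f \<in> hom C A M \<Longrightarrow> g \<in> hom C B M
      \<Longrightarrow> \<exists>!u. u \<in> hom C S M \<and> u \<cdot> inl C A B = f \<and> u \<cdot> inr C A B = g"
    using chosen_coproduct[OF AB] unfolding is_coproduct_def by blast
  then have "S = coprod C A B" unfolding coprod_def by simp
  with U[OF fg] show ?thesis by simp
qed

lemma pair_simps:
  assumes "f \<in> Arr C" "g \<in> Arr C" "Dom C g = Dom C f" "Cod C f = A" "Cod C g = B"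
  shows "pair C f g \<in> Arr C" "Dom C (pair C f g) = Dom C f" "Cod C (pair C f g) = prod_obj C A B"
    "prl C A B \<cdot> pair C f g = f" "prr C A B \<cdot> pair C f g = g"
proof -
  have "A \<in> Obj C" "B \<in> Obj C" "f \<in> hom C (Dom C f) A" "g \<in> hom C (Dom C f) B"
    using assms by auto
  from theI'[OF product_ex1[OF this]]
  have "pair C f g \<in> hom C (Dom C f) (prod_obj C A B) \<and> prl C A B \<cdot> pair C f g = f \<and> prr C A B \<cdot> pair C f g = g"
    unfolding pair_def assms(4,5) .
  then show "pair C f g \<in> Arr C" "Dom C (pair C f g) = Dom C f" "Cod C (pair C f g) = prod_obj C A B"
    "prl C A B \<cdot> pair C f g = f" "prr C A B \<cdot> pair C f g = g" by simp_all
qed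

lemma copair_simps:
  assumes "f \<in> Arr C" "g \<in> Arr C" "Cod C g = Cod C f" "Dom C f = A" "Dom C g = B"
  shows "copair C f g \<in> Arr C" "Dom C (copair C f g) = coprod C A B" "Cod C (copair C f g) = Cod C f"
    "copair C f g \<cdot> inl C A B = f" "copair C f g \<cdot> inr C A B = g"
proof -
  have "A \<in> Obj C" "B \<in> Obj C" "f \<in> hom C A (Cod C f)" "g \<in> hom C B (Cod C f)"
    using assms by auto
  from theI'[OF coproduct_ex1[OF this]]
  have "copair C f g \<in> hom C (coprod C A B) (Cod C f) \<and> copair C f g \<cdot> inl C A B = f \<and> copair C f g \<cdot> inr C A B = g"
    unfolding copair_def assms(4,5) .
  then show "copair C f g \<in> Arr C" "Dom C (copair C f g) = coprod C A B" "Cod C (copair C f g) = Cod C f"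
    "copair C f g \<cdot> inl C A B = f" "copair C f g \<cdot> inr C A B = g" by simp_all
qed

lemma product_joint_monic:
  assumes eq: "prl C A B \<cdot> u = prl C A B \<cdot> v" "prr C A B \<cdot> u = prr C A B \<cdot> v"
    and uv: "u \<in> Arr C" "v \<in> Arr C" "Dom C u = Dom C v"
      "Cod C u = prod_obj C A B" "Cod C v = prod_obj C A B" and AB: "A \<in> Obj C" "B \<in> Obj C"
  shows "u = v"
proof -
  have "prl C A B \<cdot> v \<in> hom C (Dom C v) A" "prr C A B \<cdot> v \<in> hom C (Dom C v) B"
    using uv AB by simp_all
  from product_ex1[OF AB this] show ?thesis
    by (elim ex1E) (use eq uv in \<open>metis hom_iff\<close>)
qed

lemma coproduct_joint_epic:
  assumes eq: "u \<cdot> inl C A B = v \<cdot> inl C A B" "u \<cdot> inr C A B = v \<cdot> inr C A B"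
    and uv: "u \<in> Arr C" "v \<in> Arr C" "Cod C u = Cod C v"
      "Dom C u = coprod C A B" "Dom C v = coprod C A B" and AB: "A \<in> Obj C" "B \<in> Obj C"
  shows "u = v"
proof -
  have "v \<cdot> inl C A B \<in> hom C A (Cod C v)" "v \<cdot> inr C A B \<in> hom C B (Cod C v)"
    using uv AB by simp_all
  from coproduct_ex1[OF AB this] show ?thesis
    by (elim ex1E) (use eq uv in \<open>metis hom_iff\<close>)
qed

section \<open>Kernels and cokernels\<close>

lemma kernelD:
  assumes "is_kernel C f k"
  shows "f \<in> Arr C" "k \<in> Arr C" "Cod C k = Dom C f" "f \<cdot> k = zero_arr C (Dom C k) (Cod C f)"
  using assms unfolding is_kernel_def by auto

lemma is_kernelI:
  assumes "f \<in> Arr C" "is_monic C k" "Cod C k = Dom C f" "f \<cdot> k = zero_arr C (Dom C k) (Cod C f)"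
    and "\<And>h. h \<in> Arr C \<Longrightarrow> Cod C h = Dom C f \<Longrightarrow> f \<cdot> h = zero_arr C (Dom C h) (Cod C f)
      \<Longrightarrow> factors_through C h k"
  shows "is_kernel C f k"
proof -
  have k: "k \<in> Arr C" using assms(2) by (simp add: is_monic_def)
  have "\<exists>!u. u \<in> hom C M (Dom C k) \<and> k \<cdot> u = h"
    if h: "h \<in> hom C M (Dom C f)" "f \<cdot> h = zero_arr C M (Cod C f)" for M h
  proof -
    obtain u where u: "u \<in> hom C M (Dom C k)" "k \<cdot> u = h"
      using assms(5)[of h] h unfolding factors_through_def by auto
    have "v = u" if "v \<in> hom C M (Dom C k)" "k \<cdot> v = h" for v
      using u that by - (rule monicD[OF assms(2)], auto)
    then show ?thesis using u by blast
  qed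
  then show ?thesis unfolding is_kernel_def
  proof (intro exI conjI allI ballI impI)
    show "f \<in> hom C (Dom C f) (Cod C f)" "k \<in> hom C (Dom C k) (Dom C f)" using assms k by simp_all
  qed (use assms(4) in blast)+
qed

lemma kernel_lift:
  assumes "is_kernel C f k" "h \<in> Arr C" "Cod C h = Dom C f" "f \<cdot> h = zero_arr C (Dom C h) (Cod C f)"
  obtains u where "u \<in> Arr C" "Dom C u = Dom C h" "Cod C u = Dom C k" "k \<cdot> u = h"
proof -
  have "\<exists>!u. u \<in> hom C (Dom C h) (Dom C k) \<and> k \<cdot> u = h"
    using assms unfolding is_kernel_def by auto
  then show thesis using that by auto
qed

lemma kernel_monic:
  assumes K: "is_kernel C f k"
  shows "is_monic C k"
proof (rule is_monicI)
  note k = kernelD[OF K]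
  show "k \<in> Arr C" by (fact k)
  fix u v assume uv: "u \<in> Arr C" "v \<in> Arr C" "Dom C u = Dom C v" "Cod C u = Dom C k" "Cod C v = Dom C k"
    "k \<cdot> u = k \<cdot> v"
  have "f \<cdot> (k \<cdot> v) = zero_arr C (Dom C v) (Cod C f)"
    using k uv(1-5) reassoc[OF k(4), of v] by simp
  then have "\<exists>!w. w \<in> hom C (Dom C v) (Dom C k) \<and> k \<cdot> w = k \<cdot> v"
    using K k uv(1-5) unfolding is_kernel_def by auto
  then show "u = v" using uv by auto
qed

text \<open>The kernel is the pullback along \<open>f\<close> of the arrow from a zero object. That
  arrow is monic because its domain is terminal, so its pullback is monic too.\<close>

lemma kernel_exists:
  assumes f: "f \<in> Arr C"
  obtains k where "is_kernel C f k"
proof -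
  obtain Z where Z: "zero_object C Z" "Z \<in> Obj C" by (rule zero_object_exists)
  define z where "z = zero_arr C Z (Cod C f)"
  have z: "z \<in> Arr C" "Dom C z = Z" "Cod C z = Cod C f" using Z f unfolding z_def by auto
  obtain p q where pb: "is_pullback C f z p q" using pullback_exists[OF finitely_complete f] z by metis
  note P = pullbackD[OF pb]
  have z_mono: "is_monic C z"
  proof (rule is_monicI[OF z(1)])
    fix g h assume "g \<in> Arr C" "h \<in> Arr C" "Dom C g = Dom C h" "Cod C g = Dom C z" "Cod C h = Dom C z"
    then show "g = h" using z by - (rule zero_object_terminal[OF Z(1)], auto)
  qed
  have "is_kernel C f p"
  proof (rule is_kernelI)
    show "is_monic C p" by (rule pullback_monic[OF pb z_mono])
    show "f \<cdot> p = zero_arr C (Dom C p) (Cod C f)" using P z f Z(2) unfolding z_def by simp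
    fix h assume h: "h \<in> Arr C" "Cod C h = Dom C f" "f \<cdot> h = zero_arr C (Dom C h) (Cod C f)"
    have "f \<cdot> h = z \<cdot> zero_arr C (Dom C h) Z" using h z Z f by simp
    then show "factors_through C h p"
      by (rule pullback_lift[OF pb]) (use h z Z P in \<open>auto intro: factors_throughI\<close>)
  qed (use P f in auto)
  then show thesis by (rule that)
qed

lemma cokernelD:
  assumes "is_cokernel C f q"
  shows "f \<in> Arr C" "q \<in> Arr C" "Dom C q = Cod C f" "q \<cdot> f = zero_arr C (Dom C f) (Cod C q)"
  using assms unfolding is_cokernel_def by auto

lemma cokernel_lift:
  assumes "is_cokernel C f q" "h \<in> Arr C" "Dom C h = Cod C f" "h \<cdot> f = zero_arr C (Dom C f) (Cod C h)"
  obtains u where "u \<in> Arr C" "Dom C u = Cod C q" "Cod C u = Cod C h" "u \<cdot> q = h"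
proof -
  have "\<exists>!u. u \<in> hom C (Cod C q) (Cod C h) \<and> u \<cdot> q = h"
    using assms unfolding is_cokernel_def by auto
  then show thesis using that by auto
qed

lemma cokernel_cancel:
  assumes K: "is_cokernel C f q" and eq: "u \<cdot> q = v \<cdot> q"
    and uv: "u \<in> Arr C" "v \<in> Arr C" "Dom C u = Cod C q" "Dom C v = Cod C q"
  shows "u = v"
proof -
  note k = cokernelD[OF K]
  have "(v \<cdot> q) \<cdot> f = zero_arr C (Dom C f) (Cod C v)"
    using k uv by simp
  then have "\<exists>!w. w \<in> hom C (Cod C q) (Cod C v) \<and> w \<cdot> q = v \<cdot> q"
    using K k uv unfolding is_cokernel_def by auto
  moreover have "Cod C (u \<cdot> q) = Cod C u" "Cod C (v \<cdot> q) = Cod C v" using uv k by simp_all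
  ultimately show "u = v" using uv eq by (metis hom_iff)
qed

lemma is_cokernelI:
  assumes "f \<in> Arr C" "q \<in> Arr C" "Dom C q = Cod C f" "q \<cdot> f = zero_arr C (Dom C f) (Cod C q)"
    and "\<And>h. h \<in> Arr C \<Longrightarrow> Dom C h = Cod C f \<Longrightarrow> h \<cdot> f = zero_arr C (Dom C f) (Cod C h)
      \<Longrightarrow> \<exists>u \<in> hom C (Cod C q) (Cod C h). u \<cdot> q = h"
    and "\<And>u v. u \<in> Arr C \<Longrightarrow> v \<in> Arr C \<Longrightarrow> Dom C u = Cod C q \<Longrightarrow> Dom C v = Cod C q
      \<Longrightarrow> u \<cdot> q = v \<cdot> q \<Longrightarrow> u = v"
  shows "is_cokernel C f q"
proof -
  have "\<exists>!u. u \<in> hom C (Cod C q) M \<and> u \<cdot> q = h"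
    if h: "h \<in> hom C (Cod C f) M" "h \<cdot> f = zero_arr C (Dom C f) M" for M h
  proof -
    obtain u where u: "u \<in> hom C (Cod C q) M" "u \<cdot> q = h" using assms(5)[of h] h by auto
    have "v = u" if "v \<in> hom C (Cod C q) M" "v \<cdot> q = h" for v
      using u that by - (rule assms(6), auto)
    then show ?thesis using u by blast
  qed
  then show ?thesis unfolding is_cokernel_def
  proof (intro exI conjI allI ballI impI)
    show "f \<in> hom C (Dom C f) (Cod C f)" "q \<in> hom C (Cod C f) (Cod C q)" using assms by simp_all
  qed (use assms(4) in blast)+
qed

text \<open>The axioms of a semi-abelian category are not self-dual, so \<open>kernel_exists\<close>
  cannot be applied in \<open>op_cat C\<close>. Only \<open>pullback_exists\<close> is transferred,
  and the cokernel is read off from the pushout of \<open>f\<close> along the arrow to a zero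
  object.\<close>

lemma cokernel_exists:
  assumes f: "f \<in> Arr C"
  obtains q where "is_cokernel C f q"
proof -
  obtain Z where Z: "zero_object C Z" "Z \<in> Obj C" by (rule zero_object_exists)
  define z where "z = zero_arr C (Dom C f) Z"
  have z: "z \<in> Arr C" "Cod C z = Z" "Dom C z = Dom C f" using Z f unfolding z_def by auto
  have "finitely_complete (op_cat C)" using finitely_cocomplete unfolding finitely_cocomplete_def .
  moreover have "f \<in> Arr (op_cat C)" "z \<in> Arr (op_cat C)" "Cod (op_cat C) z = Cod (op_cat C) f"
    using f z by (simp_all add: op_cat_def)
  ultimately obtain p q where "is_pullback (op_cat C) f z p q"
    by (rule category.pullback_exists[OF category_op_cat])
  then have "\<exists>P. p \<in> hom C (Cod C f) P \<and> q \<in> hom C (Cod C z) P \<and> p \<cdot> f = q \<cdot> z \<and>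
      (\<forall>M. \<forall>a \<in> hom C (Cod C f) M. \<forall>b \<in> hom C (Cod C z) M. a \<cdot> f = b \<cdot> z \<longrightarrow>
        (\<exists>!u. u \<in> hom C P M \<and> u \<cdot> p = a \<and> u \<cdot> q = b))"
    unfolding is_pullback_def hom_op_cat by (simp add: op_cat_def del: hom_iff)
  then obtain P where P: "p \<in> hom C (Cod C f) P" "q \<in> hom C Z P" "p \<cdot> f = q \<cdot> z"
    and U: "\<And>M a b. a \<in> hom C (Cod C f) M \<Longrightarrow> b \<in> hom C Z M \<Longrightarrow> a \<cdot> f = b \<cdot> z \<Longrightarrow>
      \<exists>!u. u \<in> hom C P M \<and> u \<cdot> p = a \<and> u \<cdot> q = b"
    unfolding z(2) by blast
  have PO: "P \<in> Obj C" using P by auto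
  have "is_cokernel C f p"
  proof (rule is_cokernelI)
    show "p \<cdot> f = zero_arr C (Dom C f) (Cod C p)" using P f Z(2) unfolding z_def by simp
    fix h assume h: "h \<in> Arr C" "Dom C h = Cod C f" "h \<cdot> f = zero_arr C (Dom C f) (Cod C h)"
    have "h \<cdot> f = zero_arr C Z (Cod C h) \<cdot> z" using h z Z f by simp
    then have "\<exists>!u. u \<in> hom C P (Cod C h) \<and> u \<cdot> p = h \<and> u \<cdot> q = zero_arr C Z (Cod C h)"
      using h Z P by (intro U) auto
    from ex1_implies_ex[OF this] show "\<exists>u \<in> hom C (Cod C p) (Cod C h). u \<cdot> p = h"
      using P by auto
  next
    fix u v assume uv: "u \<in> Arr C" "v \<in> Arr C" "Dom C u = Cod C p" "Dom C v = Cod C p" "u \<cdot> p = v \<cdot> p"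
    \<comment> \<open>The two arrows are not assumed to have the same codomain; equality of the
      composites forces it.\<close>
    have cod: "Cod C u = Cod C v" using uv P Comp_simps(3)[of p u] Comp_simps(3)[of p v] by simp
    have "u \<cdot> q = v \<cdot> q"
      using uv(1-4) P cod by - (rule zero_object_initial[OF Z(1)], auto)
    moreover have "(v \<cdot> p) \<cdot> f = (v \<cdot> q) \<cdot> z" using uv(1-4) P f z by simp
    then have "\<exists>!w. w \<in> hom C P (Cod C v) \<and> w \<cdot> p = v \<cdot> p \<and> w \<cdot> q = v \<cdot> q"
      using uv(1-4) P by (intro U) auto
    ultimately show "u = v" by (elim ex1E) (use uv cod P in \<open>metis hom_iff\<close>)
  qed (use P f in auto)
  then show thesis by (rule that)
qed

section \<open>Protomodularity: kernel and section generate\<close>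

lemma isoE:
  assumes "is_iso C f"
  obtains g where "g \<in> Arr C" "Dom C g = Cod C f" "Cod C g = Dom C f" "f \<cdot> g = Ident C (Cod C f)"
  using assms unfolding is_iso_def by auto

text \<open>This puts a kernel into the shape of the squares in \<open>protomodular\<close>, for
  change of base along \<open>0 -> Cod f\<close>.\<close>

lemma kernel_is_pullback:
  assumes K: "is_kernel C f k" and Z: "zero_object C Z"
  shows "is_pullback C (zero_arr C Z (Cod C f)) f (zero_arr C (Dom C k) Z) k"
  unfolding is_pullback_def
proof (intro conjI exI[of _ "Dom C k"] allI ballI impI)
  note k = kernelD[OF K]
  have ZO: "Z \<in> Obj C" using Z unfolding zero_object_def by auto
  show "zero_arr C Z (Cod C f) \<cdot> zero_arr C (Dom C k) Z = f \<cdot> k" using k ZO by simp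
  fix M a b assume ab: "a \<in> hom C M (Dom C (zero_arr C Z (Cod C f)))" "b \<in> hom C M (Dom C f)"
    "zero_arr C Z (Cod C f) \<cdot> a = f \<cdot> b"
  then have "f \<cdot> b = zero_arr C (Dom C b) (Cod C f)" using k ZO by (auto dest: sym)
  then obtain u where u: "u \<in> Arr C" "Dom C u = Dom C b" "Cod C u = Dom C k" "k \<cdot> u = b"
    using kernel_lift[OF K, of b] ab by auto
  show "\<exists>!u. u \<in> hom C M (Dom C k) \<and> zero_arr C (Dom C k) Z \<cdot> u = a \<and> k \<cdot> u = b"
  proof (rule ex1I[of _ u])
    have "zero_arr C (Dom C k) Z \<cdot> u = a"
      using u ab k ZO by - (rule zero_object_terminal[OF Z], auto)
    then show "u \<in> hom C M (Dom C k) \<and> zero_arr C (Dom C k) Z \<cdot> u = a \<and> k \<cdot> u = b"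
      using u ab by simp
    fix v assume "v \<in> hom C M (Dom C k) \<and> zero_arr C (Dom C k) Z \<cdot> v = a \<and> k \<cdot> v = b"
    then show "v = u" using u ab by - (rule monicD[OF kernel_monic[OF K]], auto)
  qed
qed (use kernelD[OF K] Z in \<open>auto simp: zero_object_def\<close>)

text \<open>Change of base along \<open>0 \<rightarrow> B\<close> sends \<open>m\<close>, viewed as a morphism of points from \<open>p \<cdot> m\<close> to \<open>p\<close>, to
  the identity of the common kernel.\<close>

lemma split_epi_strong:
  assumes p: "is_point C p s" and K: "is_kernel C p k" and m: "is_monic C m" "Cod C m = Dom C p"
    and ms: "factors_through C s m" and mk: "factors_through C k m"
  shows "is_iso C m"
proof -
  obtain Z where Z: "zero_object C Z" "Z \<in> Obj C" by (rule zero_object_exists)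
  note k = kernelD[OF K]
  have mA: "m \<in> Arr C" using m by (simp add: is_monic_def)
  have s: "s \<in> Arr C" "Dom C s = Cod C p" "Cod C s = Dom C p" "p \<cdot> s = Ident C (Cod C p)"
    using p by (auto simp: is_point_def)
  obtain s0 where s0: "s0 \<in> Arr C" "Dom C s0 = Dom C s" "Cod C s0 = Dom C m" "m \<cdot> s0 = s"
    using ms by (rule factors_throughE)
  obtain k0 where k0: "k0 \<in> Arr C" "Dom C k0 = Dom C k" "Cod C k0 = Dom C m" "m \<cdot> k0 = k"
    using mk by (rule factors_throughE)
  have K0: "is_kernel C (p \<cdot> m) k0"
  proof (rule is_kernelI)
    show "is_monic C k0" using kernel_monic[OF K] k0 mA by (intro monic_factor[of m k0]) auto
    fix h assume h: "h \<in> Arr C" "Cod C h = Dom C (p \<cdot> m)" "(p \<cdot> m) \<cdot> h = zero_arr C (Dom C h) (Cod C (p \<cdot> m))"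
    then have "p \<cdot> (m \<cdot> h) = zero_arr C (Dom C (m \<cdot> h)) (Cod C p)" using k mA m(2) by simp
    then obtain u where u: "u \<in> Arr C" "Dom C u = Dom C (m \<cdot> h)" "Cod C u = Dom C k" "k \<cdot> u = m \<cdot> h"
      using kernel_lift[OF K, of "m \<cdot> h"] h k mA m(2) by auto
    have "m \<cdot> (k0 \<cdot> u) = m \<cdot> h" using u h k k0 mA m(2) reassoc[OF k0(4), of u] by simp
    then have "k0 \<cdot> u = h" using u h k k0(1-3) mA m(2) by - (rule monicD[OF m(1)], auto)
    then show "factors_through C h k0" using u k0 by (intro factors_throughI[of k0 u]) auto
  qed (use k k0 mA m(2) in auto)
  have "is_point C (p \<cdot> m) s0" using s s0 mA m k by (simp add: is_point_def)
  moreover have "is_pullback C (zero_arr C Z (Cod C p)) (p \<cdot> m) (zero_arr C (Dom C k) Z) k0"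
    using kernel_is_pullback[OF K0 Z(1)] k0 mA m k by simp
  moreover note kernel_is_pullback[OF K Z(1)]
  moreover have "is_iso C (Ident C (Dom C k))" using k unfolding is_iso_def by auto
  ultimately show ?thesis
    using protomodular[unfolded protomodular_def, rule_format,
      of "p \<cdot> m" s0 p s m "zero_arr C Z (Cod C p)" "zero_arr C (Dom C k) Z" k0
        "zero_arr C (Dom C k) Z" k "Ident C (Dom C k)"]
      p k k0 s0 mA m Z by simp
qed

text \<open>The inverse image of \<open>x\<close> under \<open>g\<close> is a subobject of
  \<open>Dom C p\<close> through which both the section and the kernel factor, so it is everything
  by \<open>split_epi_strong\<close>.\<close>

lemma factors_through_split:
  assumes p: "is_point C p s" and K: "is_kernel C p k" and x: "is_monic C x"
    and g: "g \<in> Arr C" "Dom C g = Dom C p" "Cod C g = Cod C x"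
    and gs: "factors_through C (g \<cdot> s) x" and gk: "factors_through C (g \<cdot> k) x"
  shows "factors_through C g x"
proof -
  note k = kernelD[OF K]
  have xA: "x \<in> Arr C" using x by (simp add: is_monic_def)
  have s: "s \<in> Arr C" "Dom C s = Cod C p" "Cod C s = Dom C p" using p by (auto simp: is_point_def)
  obtain m x' where pb: "is_pullback C g x m x'"
    using pullback_exists[OF finitely_complete g(1) xA] g by metis
  note P = pullbackD[OF pb]
  have lift: "factors_through C t m"
    if gt: "factors_through C (g \<cdot> t) x" and t: "t \<in> Arr C" "Cod C t = Dom C g" for t
    using gt
  proof (rule factors_throughE)
    fix u assume u: "u \<in> Arr C" "Dom C u = Dom C (g \<cdot> t)" "Cod C u = Dom C x" "x \<cdot> u = g \<cdot> t"
    show ?thesis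
      by (rule pullback_lift[OF pb, of t u]) (use u t g P in \<open>auto intro: factors_throughI\<close>)
  qed
  have "is_iso C m"
    by (rule split_epi_strong[OF p K pullback_monic[OF pb x]])
      (use P g s k in \<open>auto intro: lift gs gk\<close>)
  then show ?thesis
  proof (rule isoE)
    fix i assume i: "i \<in> Arr C" "Dom C i = Cod C m" "Cod C i = Dom C m" "m \<cdot> i = Ident C (Cod C m)"
    have "x \<cdot> (x' \<cdot> i) = g" using i g P(1-8) reassoc[OF P(9)[symmetric], of i] by simp
    then show ?thesis using i P xA by (intro factors_throughI[of x "x' \<cdot> i"]) auto
  qed
qed

section \<open>Regular epimorphisms and images\<close>

lemma regular_cat: "regular_cat C"
  using barr_exact unfolding barr_exact_def by (rule conjunct1)

lemma pullback_regular_epi: "is_pullback C f g p q \<Longrightarrow> regular_epi C f \<Longrightarrow> regular_epi C q"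
  using regular_cat unfolding regular_cat_def by metis

text \<open>This replaces the choice of a preimage under a surjection: the generalized element
  \<open>b\<close> lifts along \<open>e\<close> after restriction to a cover \<open>c\<close>,
  obtained by pulling \<open>e\<close> back along \<open>b\<close>.\<close>

lemma regular_epi_cover:
  assumes e: "regular_epi C e" and b: "b \<in> Arr C" "Cod C b = Cod C e"
  obtains c a where "regular_epi C c" "c \<in> Arr C" "a \<in> Arr C" "Cod C c = Dom C b"
    "Dom C a = Dom C c" "Cod C a = Dom C e" "e \<cdot> a = b \<cdot> c"
proof -
  obtain a c where pb: "is_pullback C e b a c"
    using pullback_exists[OF finitely_complete regular_epi_in_Arr[OF e] b] .
  from pullbackD[OF pb] pullback_regular_epi[OF pb e] show thesis
    by (intro that[of c a]) simp_all
qed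

text \<open>The regular epimorphism is the coequalizer of the kernel pair of \<open>f\<close>. Its
  comparison \<open>m\<close> is monic because elements identified by \<open>m\<close> lift locally
  to elements identified by \<open>f\<close>, that is, to an element of the kernel pair.\<close>

lemma image_factorization_exists:
  assumes f: "f \<in> Arr C"
  obtains e m where "is_image_factorization C f e m"
proof -
  obtain p q where pb: "is_pullback C f f p q" using pullback_exists[OF finitely_complete f f refl] .
  note P = pullbackD[OF pb]
  obtain e where e: "is_coequalizer C p q e"
    using regular_cat pb unfolding regular_cat_def by metis
  then have re: "regular_epi C e" unfolding regular_epi_def by blast
  have eA: "e \<in> Arr C" by (rule regular_epi_in_Arr[OF re])
  from e obtain A B Q where *: "p \<in> hom C A B" "e \<in> hom C B Q" "e \<cdot> p = e \<cdot> q"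
    and U: "\<And>M h. h \<in> hom C B M \<Longrightarrow> h \<cdot> p = h \<cdot> q \<Longrightarrow> \<exists>!u. u \<in> hom C Q M \<and> u \<cdot> e = h"
    unfolding is_coequalizer_def by blast
  have eD: "Dom C e = Dom C f" using * P by simp
  have "\<exists>!u. u \<in> hom C Q (Cod C f) \<and> u \<cdot> e = f" using * P by (intro U) simp_all
  from ex1_implies_ex[OF this] obtain m
    where m: "m \<in> Arr C" "Dom C m = Cod C e" "Cod C m = Cod C f" "m \<cdot> e = f" using * by auto
  have "is_monic C m"
  proof (rule is_monicI[OF m(1)])
    fix u v assume uv: "u \<in> Arr C" "v \<in> Arr C" "Dom C u = Dom C v" "Cod C u = Dom C m"
      "Cod C v = Dom C m" "m \<cdot> u = m \<cdot> v"
    have "Cod C u = Cod C e" using uv m by simp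
    from regular_epi_cover[OF re uv(1) this] obtain c a
      where c: "regular_epi C c" "c \<in> Arr C" "a \<in> Arr C" "Cod C c = Dom C u"
        "Dom C a = Dom C c" "Cod C a = Dom C e" "e \<cdot> a = u \<cdot> c" .
    have "v \<cdot> c \<in> Arr C" "Cod C (v \<cdot> c) = Cod C e" using uv c(1-6) m by simp_all
    from regular_epi_cover[OF re this] obtain d b
      where d: "regular_epi C d" "d \<in> Arr C" "b \<in> Arr C" "Cod C d = Dom C (v \<cdot> c)"
        "Dom C b = Dom C d" "Cod C b = Dom C e" "e \<cdot> b = (v \<cdot> c) \<cdot> d" .
    have dC: "Cod C d = Dom C c" using d(4) uv(1-5) c(1-6) by simp
    have ead: "e \<cdot> (a \<cdot> d) = u \<cdot> (c \<cdot> d)"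
      using reassoc[OF c(7), of d] c(1-6) d(1-3,5,6) dC eA uv(1-5) m(1-3) by simp
    have eb: "e \<cdot> b = v \<cdot> (c \<cdot> d)"
      using d(7) c(1-6) d(1-3,5,6) dC eA uv(1-5) m(1-3) by simp
    have "f \<cdot> (a \<cdot> d) = m \<cdot> (u \<cdot> (c \<cdot> d))"
      using reassoc[OF m(4), of "a \<cdot> d"] ead c(1-6) d(1-3,5,6) dC eA m(1-3) by simp
    also have "\<dots> = m \<cdot> (v \<cdot> (c \<cdot> d))"
      using reassoc[OF uv(6), of "c \<cdot> d"] c(1-6) d(1-3,5,6) dC eA uv(1-5) m(1-3) by simp
    also have "\<dots> = f \<cdot> b"
      using reassoc[OF m(4), of b] eb c(1-6) d(1-3,5,6) dC eA m(1-3) by simp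
    finally have fab: "f \<cdot> (a \<cdot> d) = f \<cdot> b" .
    \<comment> \<open>The two lifts together factor through the kernel pair \<open>p, q\<close>, on
      which \<open>e\<close> agrees by construction.\<close>
    have "e \<cdot> (a \<cdot> d) = e \<cdot> b"
    proof (rule pullback_lift[OF pb fab])
      fix w assume w: "w \<in> Arr C" "Dom C w = Dom C (a \<cdot> d)" "Cod C w = Dom C p"
        "p \<cdot> w = a \<cdot> d" "q \<cdot> w = b"
      show ?thesis
        using reassoc[OF *(3), of w] w(1,3) P(1-8) eA eD unfolding w(4,5)[symmetric] by simp
    qed (use c(1-6) d(1-3,5,6) dC eA eD in simp_all)
    then have "(u \<cdot> c) \<cdot> d = (v \<cdot> c) \<cdot> d"
      using ead eb c(1-6) d(1-3,5,6) dC uv(1-5) by simp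
    then have "u \<cdot> c = v \<cdot> c"
      using c(1-6) d(1-3,5,6) dC uv(1-5) by - (rule regular_epi_cancel[OF d(1)], auto)
    then show "u = v" using c(1-6) uv(1-5) by - (rule regular_epi_cancel[OF c(1)], auto)
  qed
  then show thesis using that[of e m] re m unfolding is_image_factorization_def by simp
qed

lemma image_factorizationD:
  assumes "is_image_factorization C f e m"
  shows "regular_epi C e" "is_monic C m" "e \<in> Arr C" "m \<in> Arr C" "Cod C e = Dom C m" "m \<cdot> e = f"
    "Dom C e = Dom C f" "Cod C m = Cod C f"
proof -
  show *: "regular_epi C e" "is_monic C m" "Cod C e = Dom C m" "m \<cdot> e = f"
    using assms unfolding is_image_factorization_def by simp_all
  show **: "e \<in> Arr C" "m \<in> Arr C" using regular_epi_in_Arr[OF *(1)] *(2) unfolding is_monic_def by simp_all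
  show "Dom C e = Dom C f" "Cod C m = Cod C f" using Comp_simps(2,3)[OF ** *(3)] *(4) by simp_all
qed

text \<open>An arrow \<open>h\<close> that kills the kernel of \<open>e\<close> must be shown to
  identify the kernel pair \<open>p1, p2\<close>. By protomodularity this is tested on the diagonal,
  where it is trivial, and on the kernel of \<open>p1\<close>, which \<open>p2\<close> maps into the
  kernel of \<open>e\<close>.\<close>

lemma regular_epi_cokernel:
  assumes e: "regular_epi C e" and N: "is_kernel C e n"
  shows "is_cokernel C n e"
proof (rule is_cokernelI)
  note n = kernelD[OF N]
  show "n \<in> Arr C" "e \<in> Arr C" "Dom C e = Cod C n" "e \<cdot> n = zero_arr C (Dom C n) (Cod C e)"
    using n by simp_all
  show "u = v" if "u \<in> Arr C" "v \<in> Arr C" "Dom C u = Cod C e" "Dom C v = Cod C e" "u \<cdot> e = v \<cdot> e" for u v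
    using that by - (rule regular_epi_cancel[OF e])
  fix h assume h: "h \<in> Arr C" "Dom C h = Cod C n" "h \<cdot> n = zero_arr C (Dom C n) (Cod C h)"
  obtain p1 p2 where pb: "is_pullback C e e p1 p2" using pullback_exists[OF finitely_complete n(1) n(1) refl] .
  note P = pullbackD[OF pb]
  define M where "M = Cod C h"
  have M: "M \<in> Obj C" "Cod C h = M" using h by (simp_all add: M_def)
  define i where "i = Ident C (Dom C e)"
  have i: "i \<in> Arr C" "Dom C i = Dom C e" "Cod C i = Dom C e" using n unfolding i_def by simp_all
  obtain d where d: "d \<in> Arr C" "Dom C d = Dom C e" "Cod C d = Dom C p1" "p1 \<cdot> d = i" "p2 \<cdot> d = i"
    by (rule pullback_lift[OF pb, of i i]) (use i in simp_all)
  obtain k where K: "is_kernel C p1 k" using kernel_exists[OF P(3)] .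
  note k = kernelD[OF K]
  \<comment> \<open>The diagonal of \<open>M\<close>: the equation
    \<open>h \<cdot> p1 = h \<cdot> p2\<close> becomes a factorization of \<open>g\<close> through a
    monomorphism.\<close>
  define x where "x = pair C (Ident C M) (Ident C M)"
  have x: "x \<in> Arr C" "Dom C x = M" "Cod C x = prod_obj C M M" "prl C M M \<cdot> x = Ident C M" "prr C M M \<cdot> x = Ident C M"
    unfolding x_def using M pair_simps[of "Ident C M" "Ident C M" M M] by simp_all
  have "is_monic C (Ident C M)" using M by (intro is_monicI) auto
  then have xm: "is_monic C x" using x M by (intro monic_factor[of "prl C M M" x]) simp_all
  define g where "g = pair C (h \<cdot> p1) (h \<cdot> p2)"
  have g: "g \<in> Arr C" "Dom C g = Dom C p1" "Cod C g = prod_obj C M M"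
    "prl C M M \<cdot> g = h \<cdot> p1" "prr C M M \<cdot> g = h \<cdot> p2"
    unfolding g_def using P(1-8) M h n pair_simps[of "h \<cdot> p1" "h \<cdot> p2" M M] by simp_all
  have "e \<cdot> (p2 \<cdot> k) = zero_arr C (Dom C (p2 \<cdot> k)) (Cod C e)"
    using reassoc[OF P(9)[symmetric], of k] k P(1-8) by simp
  then obtain v where v: "v \<in> Arr C" "Dom C v = Dom C (p2 \<cdot> k)" "Cod C v = Dom C n" "n \<cdot> v = p2 \<cdot> k"
    by (rule kernel_lift[OF N, rotated 2]) (use k P(1-8) in simp_all)
  have hk: "h \<cdot> (p2 \<cdot> k) = zero_arr C (Dom C k) M"
    using reassoc[OF h(3), of v] v h(1,2) n M k(1-3) P(1-8) by simp
  have "factors_through C g x"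
  proof (rule factors_through_split[OF _ K xm])
    show "is_point C p1 d" using d P i unfolding is_point_def i_def by simp
    have "x \<cdot> h = g \<cdot> d"
    proof (rule product_joint_monic)
      show "prl C M M \<cdot> (x \<cdot> h) = prl C M M \<cdot> (g \<cdot> d)"
        using reassoc[OF x(4), of h] reassoc[OF g(4), of d] x(1-3) g(1-3) d h n M P(1-8)
        by (simp add: i_def)
      show "prr C M M \<cdot> (x \<cdot> h) = prr C M M \<cdot> (g \<cdot> d)"
        using reassoc[OF x(5), of h] reassoc[OF g(5), of d] x(1-3) g(1-3) d h n M P(1-8)
        by (simp add: i_def)
    qed (use x(1-3) g(1-3) d h n M P(1-8) in simp_all)
    then show "factors_through C (g \<cdot> d) x"
      by (rule factors_throughI) (use x h M in simp_all)
    have "x \<cdot> zero_arr C (Dom C k) M = g \<cdot> k"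
    proof (rule product_joint_monic)
      show "prl C M M \<cdot> (x \<cdot> zero_arr C (Dom C k) M) = prl C M M \<cdot> (g \<cdot> k)"
        using reassoc[OF g(4), of k] x(1-3) g(1-3) k h n M P(1-8) by simp
      show "prr C M M \<cdot> (x \<cdot> zero_arr C (Dom C k) M) = prr C M M \<cdot> (g \<cdot> k)"
        using reassoc[OF g(5), of k] hk x(1-3) g(1-3) k h n M P(1-8) by simp
    qed (use x(1-3) g(1-3) k h n M P(1-8) in simp_all)
    then show "factors_through C (g \<cdot> k) x"
      by (rule factors_throughI) (use x k M in simp_all)
  qed (use g x in simp_all)
  then obtain t where t: "t \<in> Arr C" "Dom C t = Dom C g" "Cod C t = Dom C x" "x \<cdot> t = g"
    by (rule factors_throughE)
  have "t = h \<cdot> p1" "t = h \<cdot> p2"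
    using reassoc[OF x(4), of t] reassoc[OF x(5), of t] t g(4,5) x(1-3) M by simp_all
  then have hp: "h \<cdot> p1 = h \<cdot> p2" by simp
  \<comment> \<open>The pair \<open>s, t\<close> that \<open>e\<close> coequalizes need not be its
    kernel pair, but it factors through the kernel pair.\<close>
  from e show "\<exists>u \<in> hom C (Cod C e) (Cod C h). u \<cdot> e = h"
  proof (rule regular_epiD)
    fix s t assume st: "e \<in> Arr C" "s \<in> Arr C" "t \<in> Arr C" "Dom C t = Dom C s"
      "Cod C s = Dom C e" "Cod C t = Dom C e" and eq: "e \<cdot> s = e \<cdot> t"
      and U: "\<And>h. h \<in> Arr C \<Longrightarrow> Dom C h = Dom C e \<Longrightarrow> h \<cdot> s = h \<cdot> t \<Longrightarrow>
        \<exists>!u. u \<in> hom C (Cod C e) (Cod C h) \<and> u \<cdot> e = h"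
    obtain w where w: "w \<in> Arr C" "Dom C w = Dom C s" "Cod C w = Dom C p1" "p1 \<cdot> w = s" "p2 \<cdot> w = t"
      by (rule pullback_lift[OF pb eq]) (use st in simp_all)
    have "h \<cdot> s = h \<cdot> t"
      using reassoc[OF hp, of w] w(1,3) h(1,2) n P(1-8) unfolding w(4,5)[symmetric] by simp
    moreover have "Dom C h = Dom C e" using h(2) n(3) by simp
    ultimately have "\<exists>u. u \<in> hom C (Cod C e) (Cod C h) \<and> u \<cdot> e = h"
      using ex1_implies_ex[OF U[OF h(1)]] by blast
    then show ?thesis by blast
  qed
qed

section \<open>Images of kernels\<close>

text \<open>In groups this is the observation that a reflexive relation compatible with the operations
  contains \<open>(a, c)\<close> along with \<open>(a, b)\<close> and \<open>(b, c)\<close>; here it is enough to check \<open>a = b = 0\<close> and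
  \<open>b = c\<close>, since these triples are the kernel and the section of the projection to \<open>(a, b)\<close>.\<close>

lemma reflexive_relation_transitive:
  assumes s: "s1 \<in> hom C S J" "s2 \<in> hom C S J" and mono: "is_monic C (pair C s1 s2)"
    and d: "d \<in> hom C J S" "s1 \<cdot> d = Ident C J" "s2 \<cdot> d = Ident C J"
    and pb: "is_pullback C s2 s1 p q"
  shows "\<exists>t \<in> hom C (Dom C p) S. s1 \<cdot> t = s1 \<cdot> p \<and> s2 \<cdot> t = s2 \<cdot> q"
proof -
  note P = pullbackD[OF pb]
  have J: "J \<in> Obj C" "S \<in> Obj C" using d(1) Dom_in_Obj[of d] Cod_in_Obj[of d] by auto
  define n where "n = pair C s1 s2"
  have n: "n \<in> Arr C" "Dom C n = S" "Cod C n = prod_obj C J J" "prl C J J \<cdot> n = s1" "prr C J J \<cdot> n = s2"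
    unfolding n_def using s pair_simps[of s1 s2 J J] by simp_all
  define g where "g = pair C (s1 \<cdot> p) (s2 \<cdot> q)"
  have g: "g \<in> Arr C" "Dom C g = Dom C p" "Cod C g = prod_obj C J J"
    "prl C J J \<cdot> g = s1 \<cdot> p" "prr C J J \<cdot> g = s2 \<cdot> q"
    unfolding g_def using P(1-8) s pair_simps[of "s1 \<cdot> p" "s2 \<cdot> q" J J] by simp_all
  \<comment> \<open>The section \<open>r\<close> of \<open>p\<close> sends a related pair
    \<open>(a, b)\<close> to the composable pairs \<open>(a, b)\<close> and \<open>(b, b)\<close>;
    the second one exists by reflexivity.\<close>
  have "s2 \<cdot> Ident C S = s1 \<cdot> (d \<cdot> s2)" using reassoc[OF d(2), of s2] d(1) s J by simp
  then obtain r where r: "r \<in> Arr C" "Dom C r = Dom C (Ident C S)" "Cod C r = Dom C p"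
    "p \<cdot> r = Ident C S" "q \<cdot> r = d \<cdot> s2"
    by (rule pullback_lift[OF pb]) (use d(1) s J in simp_all)
  obtain k where K: "is_kernel C p k" using kernel_exists[OF P(3)] .
  note k = kernelD[OF K]
  have "factors_through C g n"
  proof (rule factors_through_split[OF _ K])
    show "is_point C p r" using r P s J unfolding is_point_def by simp
    show "is_monic C n" unfolding n_def by (fact mono)
    have "n \<cdot> Ident C S = g \<cdot> r"
    proof (rule product_joint_monic)
      show "prl C J J \<cdot> (n \<cdot> Ident C S) = prl C J J \<cdot> (g \<cdot> r)"
        using reassoc[OF g(4), of r] n(1-4) g(1-3) r s J P(1-8) by simp
      show "prr C J J \<cdot> (n \<cdot> Ident C S) = prr C J J \<cdot> (g \<cdot> r)"
        using reassoc[OF g(5), of r] reassoc[OF d(3), of s2] d(1) n(1-3,5) g(1-3) r s J P(1-8) by simp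
    qed (use n(1-3) g(1-3) r s J P(1-8) in simp_all)
    then show "factors_through C (g \<cdot> r) n" by (rule factors_throughI) (use n J in simp_all)
    \<comment> \<open>On the kernel of \<open>p\<close> the composable pairs are
      \<open>(0, 0)\<close> and \<open>(0, c)\<close>, so the second pair is itself the required
      composite.\<close>
    have sqk: "s1 \<cdot> (q \<cdot> k) = zero_arr C (Dom C k) J"
      using reassoc[OF P(9)[symmetric], of k] k P(1-8) s J by simp
    have "n \<cdot> (q \<cdot> k) = g \<cdot> k"
    proof (rule product_joint_monic)
      show "prl C J J \<cdot> (n \<cdot> (q \<cdot> k)) = prl C J J \<cdot> (g \<cdot> k)"
        using reassoc[OF g(4), of k] reassoc[OF n(4), of "q \<cdot> k"] sqk n(1-3) g(1-3) k s J P(1-8) by simp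
      show "prr C J J \<cdot> (n \<cdot> (q \<cdot> k)) = prr C J J \<cdot> (g \<cdot> k)"
        using reassoc[OF g(5), of k] reassoc[OF n(5), of "q \<cdot> k"] n(1-3) g(1-3) k s J P(1-8) by simp
    qed (use n(1-3) g(1-3) k s J P(1-8) in simp_all)
    then show "factors_through C (g \<cdot> k) n" by (rule factors_throughI) (use n k P(1-8) s in simp_all)
  qed (use g n in simp_all)
  then obtain t where t: "t \<in> Arr C" "Dom C t = Dom C g" "Cod C t = Dom C n" "n \<cdot> t = g"
    by (rule factors_throughE)
  have "s1 \<cdot> t = s1 \<cdot> p" "s2 \<cdot> t = s2 \<cdot> q"
    using reassoc[OF n(4), of t] reassoc[OF n(5), of t] t g n(1-3) J by simp_all
  then show ?thesis using t n g by auto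
qed

text \<open>In groups, \<open>e b = e (a^-1 b)\<close> with \<open>a^-1 b\<close> in the kernel of
  \<open>r\<close>. Without division, one considers all pairs \<open>(a, b)\<close> with
  \<open>e a = 0\<close> and \<open>r a = r b\<close>, projected to \<open>a\<close>: the section
  consists of pairs \<open>(a, a)\<close>, where \<open>e\<close> vanishes on the second entry, and
  the kernel consists of pairs \<open>(0, b)\<close> with \<open>b\<close> in the kernel of
  \<open>r\<close>.\<close>

lemma image_kernel_factors:
  assumes K: "is_kernel C r k" and e: "e \<in> Arr C" "Dom C e = Dom C r"
    and x: "is_monic C x" "Cod C x = Cod C e" and ek: "factors_through C (e \<cdot> k) x"
    and ab: "a \<in> Arr C" "b \<in> Arr C" "Cod C a = Dom C r" "Cod C b = Dom C r" "Dom C b = Dom C a"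
      "r \<cdot> a = r \<cdot> b" "e \<cdot> a = zero_arr C (Dom C a) (Cod C e)"
  shows "factors_through C (e \<cdot> b) x"
proof -
  note k = kernelD[OF K]
  have xA: "x \<in> Arr C" using x(1) by (simp add: is_monic_def)
  have cod: "Cod C x \<in> Obj C" "Dom C x \<in> Obj C" using xA by simp_all
  obtain n where N: "is_kernel C e n" using kernel_exists[OF e(1)] .
  note n = kernelD[OF N]
  have "r \<cdot> n \<in> Arr C" "r \<in> Arr C" "Cod C r = Cod C (r \<cdot> n)" using n k e by simp_all
  then obtain p q where pb: "is_pullback C (r \<cdot> n) r p q"
    using pullback_exists[OF finitely_complete] by metis
  note P = pullbackD[OF pb]
  have Pn: "Cod C p = Dom C n" "(r \<cdot> n) \<cdot> p = r \<cdot> q" using P n k e by simp_all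
  have rnp: "r \<cdot> (n \<cdot> p) = r \<cdot> q" using Pn P(3) n k e by simp
  have "(r \<cdot> n) \<cdot> Ident C (Dom C n) = r \<cdot> n" using n k e by simp
  then obtain s where s: "s \<in> Arr C" "Dom C s = Dom C n" "Cod C s = Dom C p"
      "p \<cdot> s = Ident C (Dom C n)" "q \<cdot> s = n"
    by (rule pullback_lift[OF pb]) (use n k e in simp_all)
  obtain l where L: "is_kernel C p l" using kernel_exists[OF P(3)] .
  note l = kernelD[OF L]
  have zero: "factors_through C (zero_arr C M (Cod C e)) x" if "M \<in> Obj C" for M
    using that xA x(2) cod by (intro factors_throughI[of x "zero_arr C M (Dom C x)"]) simp_all
  have eq: "factors_through C (e \<cdot> q) x"
  proof (rule factors_through_split[OF _ L x(1)])
    show "is_point C p s" using s P(3) Pn(1) n unfolding is_point_def by simp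
    have "(e \<cdot> q) \<cdot> s = zero_arr C (Dom C n) (Cod C e)" using s P(4,7,8) n k e by simp
    then show "factors_through C ((e \<cdot> q) \<cdot> s) x" using zero n by simp
    have "r \<cdot> (q \<cdot> l) = zero_arr C (Dom C (q \<cdot> l)) (Cod C r)"
      using reassoc[OF rnp[symmetric], of l] l P(3,4,7,8) Pn(1) n k e by simp
    then obtain v where v: "v \<in> Arr C" "Dom C v = Dom C (q \<cdot> l)" "Cod C v = Dom C k" "k \<cdot> v = q \<cdot> l"
      by (rule kernel_lift[OF K, rotated 2]) (use l P(4,7,8) in simp_all)
    have "factors_through C ((e \<cdot> k) \<cdot> v) x"
      using v k e xA by (intro factors_through_comp[OF ek]) simp_all
    moreover have "(e \<cdot> k) \<cdot> v = (e \<cdot> q) \<cdot> l" using v(1,3,4) l P(4,7,8) k e by simp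
    ultimately show "factors_through C ((e \<cdot> q) \<cdot> l) x" by simp
  qed (use P(4,7,8) e x in simp_all)
  obtain a' where a': "a' \<in> Arr C" "Dom C a' = Dom C a" "Cod C a' = Dom C n" "n \<cdot> a' = a"
    by (rule kernel_lift[OF N, of a]) (use ab e in simp_all)
  have "(r \<cdot> n) \<cdot> a' = r \<cdot> b" using a' ab(6) n k e by simp
  then obtain v where v: "v \<in> Arr C" "Dom C v = Dom C a'" "Cod C v = Dom C p" "p \<cdot> v = a'" "q \<cdot> v = b"
    by (rule pullback_lift[OF pb]) (use a' ab(1-5) n k e in simp_all)
  have "factors_through C ((e \<cdot> q) \<cdot> v) x"
    using v P(4,7,8) e xA by (intro factors_through_comp[OF eq]) simp_all
  then show ?thesis using v P(4,7,8) e by simp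
qed

text \<open>The image \<open>S\<close> under \<open>e\<close> of the kernel pair of \<open>r\<close> is an equivalence relation on the codomain
  of \<open>e\<close>; the image of \<open>k\<close> is the class of zero, hence the kernel of the quotient map of \<open>S\<close>.\<close>

lemma regular_image_proper:
  assumes K: "is_kernel C r k" and e: "regular_epi C e" and eD: "Dom C e = Dom C r"
    and im: "is_image_factorization C (e \<cdot> k) h x"
  shows "is_proper C x"
proof -
  note k = kernelD[OF K]
  have eA: "e \<in> Arr C" by (rule regular_epi_in_Arr[OF e])
  note x = image_factorizationD[OF im]
  have xc: "Cod C x = Cod C e" "Dom C h = Dom C k" using x eA k eD by simp_all
  define J where "J = Cod C e"
  have J: "J \<in> Obj C" "Cod C e = J" using eA unfolding J_def by simp_all
  obtain r1 r2 where pb: "is_pullback C r r r1 r2" using pullback_exists[OF finitely_complete k(1) k(1) refl] .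
  note P = pullbackD[OF pb]
  \<comment> \<open>The kernel pair of \<open>r\<close> is mapped into \<open>J\<close> times
    \<open>J\<close>, and \<open>S\<close> will be the image of this map.\<close>
  define g where "g = pair C (e \<cdot> r1) (e \<cdot> r2)"
  have g: "g \<in> Arr C" "Dom C g = Dom C r1" "Cod C g = prod_obj C J J"
    "prl C J J \<cdot> g = e \<cdot> r1" "prr C J J \<cdot> g = e \<cdot> r2"
    unfolding g_def using P(1-8) eA eD J pair_simps[of "e \<cdot> r1" "e \<cdot> r2" J J] by simp_all
  obtain c n where cn: "is_image_factorization C g c n" using image_factorization_exists[OF g(1)] .
  note cn = image_factorizationD[OF cn]
  define S where "S = Dom C n"
  define s1 where "s1 = prl C J J \<cdot> n"
  define s2 where "s2 = prr C J J \<cdot> n"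
  have n: "n \<in> Arr C" "Dom C n = S" "Cod C n = prod_obj C J J" using cn g unfolding S_def by simp_all
  have c: "c \<in> Arr C" "Dom C c = Dom C r1" "Cod C c = S" using cn g unfolding S_def by simp_all
  have s: "s1 \<in> Arr C" "Dom C s1 = S" "Cod C s1 = J" "s2 \<in> Arr C" "Dom C s2 = S" "Cod C s2 = J"
    unfolding s1_def s2_def using n J by simp_all
  have S: "S \<in> Obj C" using n by auto
  have sc: "s1 \<cdot> c = e \<cdot> r1" "s2 \<cdot> c = e \<cdot> r2"
    using n c J cn(6) g(4,5) unfolding s1_def s2_def by simp_all
  have pn: "pair C s1 s2 = n"
    using pair_simps[of s1 s2 J J] s n J
    by - (rule product_joint_monic[of J J], auto simp: s1_def s2_def)
  have jm: "w = w'" if "s1 \<cdot> w = s1 \<cdot> w'" "s2 \<cdot> w = s2 \<cdot> w'" "w \<in> Arr C" "w' \<in> Arr C"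
    "Dom C w = Dom C w'" "Cod C w = S" "Cod C w' = S" for w w'
  proof (rule monicD[OF cn(2)])
    show "n \<cdot> w = n \<cdot> w'"
      using that n J by - (rule product_joint_monic[of J J], auto simp: s1_def s2_def)
  qed (use that n in simp_all)
  \<comment> \<open>Generalized elements identified by \<open>r\<close> have related images under
    \<open>e\<close>.\<close>
  have rel_intro: "\<exists>w \<in> hom C (Dom C a) S. s1 \<cdot> w = e \<cdot> a \<and> s2 \<cdot> w = e \<cdot> b"
    if ab: "a \<in> Arr C" "b \<in> Arr C" "Cod C a = Dom C r" "Cod C b = Dom C r" "Dom C b = Dom C a"
      "r \<cdot> a = r \<cdot> b" for a b
  proof -
    obtain v where v: "v \<in> Arr C" "Dom C v = Dom C a" "Cod C v = Dom C r1" "r1 \<cdot> v = a" "r2 \<cdot> v = b"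
      by (rule pullback_lift[OF pb ab(6)]) (use ab in simp_all)
    have "s1 \<cdot> (c \<cdot> v) = e \<cdot> a" "s2 \<cdot> (c \<cdot> v) = e \<cdot> b"
      using reassoc[OF sc(1), of v] reassoc[OF sc(2), of v] v c s P(1-8) eA eD by simp_all
    then show ?thesis using v c by (intro bexI[of _ "c \<cdot> v"]) simp_all
  qed
  \<comment> \<open>Membership in \<open>S\<close> may be tested on a cover, because
    \<open>n\<close> is monic.\<close>
  have rel_local: "\<exists>w \<in> hom C (Dom C a) S. s1 \<cdot> w = a \<and> s2 \<cdot> w = b"
    if d: "regular_epi C d" "Cod C d = Dom C a"
      and ab: "a \<in> Arr C" "b \<in> Arr C" "Cod C a = J" "Cod C b = J" "Dom C b = Dom C a"
      and w: "w \<in> Arr C" "Dom C w = Dom C d" "Cod C w = S" "s1 \<cdot> w = a \<cdot> d" "s2 \<cdot> w = b \<cdot> d" for a b d w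
  proof -
    have dA: "d \<in> Arr C" by (rule regular_epi_in_Arr[OF d(1)])
    note q = pair_simps[of a b J J, OF ab(1,2,5,3,4)]
    have "n \<cdot> w = pair C a b \<cdot> d"
    proof (rule product_joint_monic)
      show "prl C J J \<cdot> (n \<cdot> w) = prl C J J \<cdot> (pair C a b \<cdot> d)"
        using reassoc[OF q(4), of d] q(1-3) w dA d(2) n J by (simp add: s1_def)
      show "prr C J J \<cdot> (n \<cdot> w) = prr C J J \<cdot> (pair C a b \<cdot> d)"
        using reassoc[OF q(5), of d] q(1-3) w dA d(2) n J by (simp add: s2_def)
    qed (use q(1-3) w dA d(2) n J in simp_all)
    then have "factors_through C (pair C a b \<cdot> d) n"
      by (rule factors_throughI) (use w n in simp_all)
    with q d(2) n have "factors_through C (pair C a b) n"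
      by - (rule factors_through_local[OF cn(2) d(1)], simp_all)
    then obtain u where u: "u \<in> Arr C" "Dom C u = Dom C (pair C a b)" "Cod C u = Dom C n" "n \<cdot> u = pair C a b"
      by (rule factors_throughE)
    have "s1 \<cdot> u = a" "s2 \<cdot> u = b" using u q n J by (simp_all add: s1_def s2_def)
    then show ?thesis using u q n by (intro bexI[of _ u]) simp_all
  qed
  \<comment> \<open>Conversely, each generalized element of \<open>S\<close> comes, after passing to
    a cover, from two elements identified by \<open>r\<close>.\<close>
  have rel_elim: "\<exists>d a b. regular_epi C d \<and> d \<in> Arr C \<and> Cod C d = Dom C w \<and> a \<in> hom C (Dom C d) (Dom C r) \<and>
      b \<in> hom C (Dom C d) (Dom C r) \<and> r \<cdot> a = r \<cdot> b \<and> e \<cdot> a = s1 \<cdot> (w \<cdot> d) \<and> e \<cdot> b = s2 \<cdot> (w \<cdot> d)"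
    if w: "w \<in> Arr C" "Cod C w = S" for w
  proof -
    have "Cod C w = Cod C c" using w c by simp
    from regular_epi_cover[OF cn(1) w(1) this] obtain d v
      where d: "regular_epi C d" "d \<in> Arr C" "v \<in> Arr C" "Cod C d = Dom C w" "Dom C v = Dom C d"
        "Cod C v = Dom C c" "c \<cdot> v = w \<cdot> d" .
    have "r \<cdot> (r1 \<cdot> v) = r \<cdot> (r2 \<cdot> v)" using reassoc[OF P(9), of v] d c P(1-8) by simp
    moreover have "e \<cdot> (r1 \<cdot> v) = s1 \<cdot> (w \<cdot> d)" "e \<cdot> (r2 \<cdot> v) = s2 \<cdot> (w \<cdot> d)"
      using reassoc[OF sc(1), of v] reassoc[OF sc(2), of v] d c s w P(1-8) eA eD by simp_all
    ultimately show ?thesis using d c P(1-8)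
      by - (rule exI[of _ d], rule exI[of _ "r1 \<cdot> v"], rule exI[of _ "r2 \<cdot> v"], simp)
  qed
  \<comment> \<open>The pair \<open>(e, e)\<close> lies in \<open>S\<close>, and \<open>e\<close>
    itself serves as the cover of \<open>J\<close> along which reflexivity descends.\<close>
  have refl: "\<exists>d \<in> hom C J S. s1 \<cdot> d = Ident C J \<and> s2 \<cdot> d = Ident C J"
  proof -
    obtain w where "w \<in> hom C (Dom C r) S" "s1 \<cdot> w = e" "s2 \<cdot> w = e"
      using rel_intro[of "Ident C (Dom C r)" "Ident C (Dom C r)"] k eA eD by auto
    then show ?thesis using rel_local[of e "Ident C J" "Ident C J" w] e J eA eD by simp
  qed
  then obtain \<delta> where \<delta>: "\<delta> \<in> hom C J S" "s1 \<cdot> \<delta> = Ident C J" "s2 \<cdot> \<delta> = Ident C J" by blast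
  have sym: "\<exists>t \<in> hom C S S. s1 \<cdot> t = s2 \<and> s2 \<cdot> t = s1"
  proof -
    obtain d a b where d: "regular_epi C d" "d \<in> Arr C" "Cod C d = S" "a \<in> hom C (Dom C d) (Dom C r)"
      "b \<in> hom C (Dom C d) (Dom C r)" "r \<cdot> a = r \<cdot> b" "e \<cdot> a = s1 \<cdot> d" "e \<cdot> b = s2 \<cdot> d"
      using rel_elim[of "Ident C S"] S by auto
    then obtain w where "w \<in> hom C (Dom C d) S" "s1 \<cdot> w = s2 \<cdot> d" "s2 \<cdot> w = s1 \<cdot> d"
      using rel_intro[of b a] by auto
    then show ?thesis using rel_local[of d s2 s1 w] d s by simp
  qed
  have "equivalence_relation C s1 s2"
    unfolding equivalence_relation_def
  proof (intro exI conjI allI ballI impI)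
    show "s1 \<in> hom C S J" "s2 \<in> hom C S J" using s by simp_all
    show "u = v" if "u \<in> hom C M S" "v \<in> hom C M S" "s1 \<cdot> u = s1 \<cdot> v \<and> s2 \<cdot> u = s2 \<cdot> v" for M u v
      using that by - (rule jm, simp_all)
    \<comment> \<open>Reflexivity and symmetry pass to images in any regular category; transitivity
      does not, and comes from protomodularity.\<close>
    show "\<exists>t \<in> hom C (Dom C p) S. s1 \<cdot> t = s1 \<cdot> p \<and> s2 \<cdot> t = s2 \<cdot> q" if "is_pullback C s2 s1 p q" for p q
      using reflexive_relation_transitive[OF _ _ _ \<delta> that] s pn cn(2) by simp
  qed (use refl sym in simp_all)
  \<comment> \<open>Exactness supplies an arrow whose kernel pair is \<open>S\<close>; this is the
    arrow whose kernel will be \<open>x\<close>.\<close>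
  then obtain f where f: "is_pullback C f f s1 s2" using barr_exact unfolding barr_exact_def by blast
  note F = pullbackD[OF f]
  have fD: "Dom C f = J" using F s by simp
  have "is_kernel C f x"
  proof (rule is_kernelI)
    show "f \<cdot> x = zero_arr C (Dom C x) (Cod C f)"
    proof (rule regular_epi_cancel[OF x(1)])
      define z where "z = zero_arr C (Dom C k) (Dom C r)"
      have z: "z \<in> Arr C" "Dom C z = Dom C k" "Cod C z = Dom C r" unfolding z_def using k by simp_all
      \<comment> \<open>The pair \<open>(k, 0)\<close> is identified by \<open>r\<close>, so its
        image \<open>(e \<cdot> k, 0)\<close> lies in \<open>S\<close> and \<open>f\<close> kills
        \<open>e \<cdot> k = x \<cdot> h\<close>.\<close>
      have "r \<cdot> k = r \<cdot> z" using k unfolding z_def by simp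
      then obtain w where w: "w \<in> hom C (Dom C k) S" "s1 \<cdot> w = e \<cdot> k" "s2 \<cdot> w = e \<cdot> z"
        using rel_intro[of k z] z k by auto
      have "f \<cdot> (e \<cdot> k) = f \<cdot> (e \<cdot> z)"
        using reassoc[OF F(9), of w] w s F(1-8) fD by simp
      also have "\<dots> = zero_arr C (Dom C k) (Cod C f)" using F(1) fD eA eD J k unfolding z_def by simp
      finally show "(f \<cdot> x) \<cdot> h = zero_arr C (Dom C x) (Cod C f) \<cdot> h"
        using x(3-6) xc F(1) fD J by simp
    qed (use x(3-5) xc F(1) fD J in simp_all)
    fix t assume t: "t \<in> Arr C" "Cod C t = Dom C f" "f \<cdot> t = zero_arr C (Dom C t) (Cod C f)"
    \<comment> \<open>Being killed by \<open>f\<close> means that \<open>(0, t)\<close> lies in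
      \<open>S\<close>. Locally this pair is \<open>(e a, e b)\<close> with
      \<open>r a = r b\<close>, the situation of \<open>image_kernel_factors\<close>.\<close>
    have "f \<cdot> zero_arr C (Dom C t) J = f \<cdot> t" using t F(1) fD by simp
    then obtain w where w: "w \<in> Arr C" "Dom C w = Dom C (zero_arr C (Dom C t) J)" "Cod C w = Dom C s1"
      "s1 \<cdot> w = zero_arr C (Dom C t) J" "s2 \<cdot> w = t"
      by (rule pullback_lift[OF f]) (use t J F(1) fD in simp_all)
    have wD: "Dom C w = Dom C t" using w(2) t J by simp
    obtain d a b where d: "regular_epi C d" "d \<in> Arr C" "Cod C d = Dom C w" "a \<in> hom C (Dom C d) (Dom C r)"
      "b \<in> hom C (Dom C d) (Dom C r)" "r \<cdot> a = r \<cdot> b" "e \<cdot> a = s1 \<cdot> (w \<cdot> d)" "e \<cdot> b = s2 \<cdot> (w \<cdot> d)"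
      using rel_elim[of w] w(1,3) s by auto
    have ea: "e \<cdot> a = zero_arr C (Dom C a) (Cod C e)"
      using d reassoc[OF w(4), of d] w(1,3) s wD J t by simp
    have eb: "e \<cdot> b = t \<cdot> d" using d reassoc[OF w(5), of d] w(1,3) s by simp
    have "factors_through C (e \<cdot> k) x" by (rule factors_throughI[OF x(6)]) (use x in simp_all)
    then have "factors_through C (e \<cdot> b) x"
      using d ea by (intro image_kernel_factors[OF K eA eD x(2) xc(1), of a b]) simp_all
    then show "factors_through C t x"
      using factors_through_local[OF x(2) d(1) t(1)] t(2) d(3) wD eb xc fD J by simp
  qed (use x F xc fD J in simp_all)
  then show ?thesis unfolding is_proper_def by blast
qed

section \<open>Normalization and properness\<close>

lemma ker_is_kernel: "f \<in> Arr C \<Longrightarrow> is_kernel C f (ker C f)"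
  unfolding ker_def by (rule kernel_exists[of f], assumption, rule someI)

lemma coker_is_cokernel: "f \<in> Arr C \<Longrightarrow> is_cokernel C f (coker C f)"
  unfolding coker_def by (rule cokernel_exists[of f], assumption, rule someI)

lemma join_image_factorization:
  assumes "copair C x y \<in> Arr C"
  shows "is_image_factorization C (copair C x y) (join_epi C x y) (join_incl C x y)"
proof -
  obtain e m where "is_image_factorization C (copair C x y) e m"
    by (rule image_factorization_exists[OF assms])
  then have "case (SOME (e, m). is_image_factorization C (copair C x y) e m) of
      (e, m) \<Rightarrow> is_image_factorization C (copair C x y) e m"
    by (intro someI[of "\<lambda>(e, m). is_image_factorization C (copair C x y) e m" "(e, m)"]) simp
  then show ?thesis unfolding join_epi_def join_incl_def by (simp add: case_prod_beta)
qed

lemma meet_is_pullback: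
  assumes "x \<in> Arr C" "y \<in> Arr C" "Cod C y = Cod C x"
  obtains p where "is_pullback C x y p (meet_incl C x y)"
proof -
  obtain p q where "is_pullback C x y p q" using pullback_exists[OF finitely_complete assms] .
  then have "case (SOME (p, q). is_pullback C x y p q) of (p, q) \<Rightarrow> is_pullback C x y p q"
    by (intro someI[of "\<lambda>(p, q). is_pullback C x y p q" "(p, q)"]) simp
  then show thesis using that unfolding meet_incl_def by (simp add: case_prod_beta)
qed

lemma factorization_eq:
  assumes "is_monic C m" "m \<cdot> u = f" "u \<in> Arr C" "Cod C u = Dom C m"
  shows "factorization C f m = u"
  unfolding factorization_def
proof (rule the_equality)
  have m: "m \<in> Arr C" using assms(1) by (simp add: is_monic_def)
  have D: "Dom C f = Dom C u" using Comp_simps(2)[OF assms(3) m assms(4)] assms(2) by simp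
  show "u \<in> hom C (Dom C f) (Dom C m) \<and> m \<cdot> u = f" using assms D by simp
  fix v assume "v \<in> hom C (Dom C f) (Dom C m) \<and> m \<cdot> v = f"
  then show "v = u" using assms D by - (rule monicD[OF assms(1)], auto)
qed

section \<open>The cosmash product and the conjugation action\<close>

lemma retr_simps [simp]:
  assumes "X \<in> Obj C" "Y \<in> Obj C"
  shows "retr C X Y \<in> Arr C" "Dom C (retr C X Y) = coprod C X Y" "Cod C (retr C X Y) = Y"
    "retr C X Y \<cdot> inl C X Y = zero_arr C X Y" "retr C X Y \<cdot> inr C X Y = Ident C Y"
  unfolding retr_def using assms copair_simps[of "zero_arr C X Y" "Ident C Y" X Y] by simp_all

lemma coprod_map_simps:
  assumes "f \<in> hom C A A'" "g \<in> hom C G G'"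
  shows "coprod_map C f g \<in> hom C (coprod C A G) (coprod C A' G')"
    "coprod_map C f g \<cdot> inl C A G = inl C A' G' \<cdot> f" "coprod_map C f g \<cdot> inr C A G = inr C A' G' \<cdot> g"
proof -
  have "A' \<in> Obj C" "G' \<in> Obj C" using assms by auto
  then show "coprod_map C f g \<in> hom C (coprod C A G) (coprod C A' G')"
    "coprod_map C f g \<cdot> inl C A G = inl C A' G' \<cdot> f" "coprod_map C f g \<cdot> inr C A G = inr C A' G' \<cdot> g"
    unfolding coprod_map_def using assms copair_simps[of "inl C A' G' \<cdot> f" "inr C A' G' \<cdot> g" A G]
    by simp_all
qed

text \<open>This makes \<open>(A|G)\<close> the intersection of the kernels of the two retractions
  of \<open>A + G\<close>, one of which is \<open>retr\<close>.\<close>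

lemma coprod_to_prod_eq_zero_iff:
  assumes A: "A \<in> Obj C" "G \<in> Obj C" and t: "t \<in> Arr C" "Cod C t = coprod C A G"
  shows "coprod_to_prod C A G \<cdot> t = zero_arr C (Dom C t) (prod_obj C A G) \<longleftrightarrow>
    copair C (Ident C A) (zero_arr C G A) \<cdot> t = zero_arr C (Dom C t) A \<and>
    retr C A G \<cdot> t = zero_arr C (Dom C t) G"
    and "coprod_to_prod C A G \<in> hom C (coprod C A G) (prod_obj C A G)"
proof -
  define l where "l = copair C (Ident C A) (zero_arr C G A)"
  have l: "l \<in> Arr C" "Dom C l = coprod C A G" "Cod C l = A"
    unfolding l_def using A copair_simps[of "Ident C A" "zero_arr C G A" A G] by simp_all
  define c where "c = coprod_to_prod C A G"
  have c_eq: "c = pair C l (retr C A G)" unfolding c_def l_def retr_def coprod_to_prod_def ..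
  have c: "c \<in> Arr C" "Dom C c = coprod C A G" "Cod C c = prod_obj C A G"
    "prl C A G \<cdot> c = l" "prr C A G \<cdot> c = retr C A G"
    unfolding c_eq using A l pair_simps[of l "retr C A G" A G] by simp_all
  have pr: "prl C A G \<cdot> (c \<cdot> t) = l \<cdot> t" "prr C A G \<cdot> (c \<cdot> t) = retr C A G \<cdot> t"
    using reassoc[OF c(4), of t] reassoc[OF c(5), of t] t c(1-3) A by simp_all
  have "c \<cdot> t = zero_arr C (Dom C t) (prod_obj C A G) \<longleftrightarrow>
      l \<cdot> t = zero_arr C (Dom C t) A \<and> retr C A G \<cdot> t = zero_arr C (Dom C t) G"
  proof
    assume "c \<cdot> t = zero_arr C (Dom C t) (prod_obj C A G)"
    then show "l \<cdot> t = zero_arr C (Dom C t) A \<and> retr C A G \<cdot> t = zero_arr C (Dom C t) G"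
      using pr A t by simp
  next
    assume "l \<cdot> t = zero_arr C (Dom C t) A \<and> retr C A G \<cdot> t = zero_arr C (Dom C t) G"
    then show "c \<cdot> t = zero_arr C (Dom C t) (prod_obj C A G)"
      using pr A t c(1-3) by - (rule product_joint_monic[of A G], simp_all)
  qed
  then show "coprod_to_prod C A G \<cdot> t = zero_arr C (Dom C t) (prod_obj C A G) \<longleftrightarrow>
    copair C (Ident C A) (zero_arr C G A) \<cdot> t = zero_arr C (Dom C t) A \<and>
    retr C A G \<cdot> t = zero_arr C (Dom C t) G" unfolding c_def l_def .
  show "coprod_to_prod C A G \<in> hom C (coprod C A G) (prod_obj C A G)"
    using c unfolding c_def by simp
qed

lemma cosmash_incl:
  assumes A: "A \<in> Obj C" "G \<in> Obj C"
  shows "is_monic C (cosmash_incl C A G)" "cosmash_incl C A G \<in> Arr C"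
    "Cod C (cosmash_incl C A G) = coprod C A G"
    "copair C (Ident C A) (zero_arr C G A) \<cdot> cosmash_incl C A G = zero_arr C (Dom C (cosmash_incl C A G)) A"
    "retr C A G \<cdot> cosmash_incl C A G = zero_arr C (Dom C (cosmash_incl C A G)) G"
    and "\<And>t. t \<in> Arr C \<Longrightarrow> Cod C t = coprod C A G
      \<Longrightarrow> copair C (Ident C A) (zero_arr C G A) \<cdot> t = zero_arr C (Dom C t) A
      \<Longrightarrow> retr C A G \<cdot> t = zero_arr C (Dom C t) G \<Longrightarrow> factors_through C t (cosmash_incl C A G)"
proof -
  have c: "coprod_to_prod C A G \<in> hom C (coprod C A G) (prod_obj C A G)"
    using coprod_to_prod_eq_zero_iff(2)[OF A, of "Ident C (coprod C A G)"] A by simp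
  have K: "is_kernel C (coprod_to_prod C A G) (cosmash_incl C A G)"
    unfolding cosmash_incl_def using c by (intro ker_is_kernel) simp
  note k = kernelD[OF K]
  show "is_monic C (cosmash_incl C A G)" by (rule kernel_monic[OF K])
  show i: "cosmash_incl C A G \<in> Arr C" "Cod C (cosmash_incl C A G) = coprod C A G" using k c by simp_all
  show "copair C (Ident C A) (zero_arr C G A) \<cdot> cosmash_incl C A G = zero_arr C (Dom C (cosmash_incl C A G)) A"
    "retr C A G \<cdot> cosmash_incl C A G = zero_arr C (Dom C (cosmash_incl C A G)) G"
    using coprod_to_prod_eq_zero_iff(1)[OF A i] k(4) c by simp_all
  fix t assume t: "t \<in> Arr C" "Cod C t = coprod C A G"
    "copair C (Ident C A) (zero_arr C G A) \<cdot> t = zero_arr C (Dom C t) A"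
    "retr C A G \<cdot> t = zero_arr C (Dom C t) G"
  then have "coprod_to_prod C A G \<cdot> t = zero_arr C (Dom C t) (Cod C (coprod_to_prod C A G))"
    using coprod_to_prod_eq_zero_iff(1)[OF A t(1,2)] c by simp
  then obtain u where "u \<in> Arr C" "Cod C u = Dom C (cosmash_incl C A G)" "cosmash_incl C A G \<cdot> u = t"
    by (rule kernel_lift[OF K, rotated 2]) (use t c in simp_all)
  then show "factors_through C t (cosmash_incl C A G)" using i by (intro factors_throughI) simp_all
qed

text \<open>The codiagonal composed with \<open>x + y\<close> is \<open>copair C x y\<close>.
  Naturality of both retractions shows that \<open>x + y\<close> carries \<open>(X|Y)\<close> into
  \<open>(A|A)\<close>, so that the \<open>THE\<close> behind \<open>cosmash_map\<close> denotes an
  actual factorization.\<close>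

lemma conj_action_cosmash_map:
  assumes x: "x \<in> hom C X A" and y: "y \<in> hom C Y A"
  shows "conj_action C A \<cdot> cosmash_map C x y = copair C x y \<cdot> cosmash_incl C X Y"
proof -
  have obj: "X \<in> Obj C" "Y \<in> Obj C" "A \<in> Obj C" using x y by auto
  note i = cosmash_incl[OF obj(1,2)] and j = cosmash_incl[OF obj(3,3)]
  have xy: "copair C x y \<in> Arr C" "Dom C (copair C x y) = coprod C X Y" "Cod C (copair C x y) = A"
    "copair C x y \<cdot> inl C X Y = x" "copair C x y \<cdot> inr C X Y = y"
    using x y copair_simps[of x y X Y] by simp_all
  note c = coprod_map_simps[OF x y]
  have cA: "coprod_map C x y \<in> Arr C" "Dom C (coprod_map C x y) = coprod C X Y"
    "Cod C (coprod_map C x y) = coprod C A A" using c(1) by simp_all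
  define l where "l = (\<lambda>X Y. copair C (Ident C X) (zero_arr C Y X))"
  have l: "l X Y \<in> Arr C" "Dom C (l X Y) = coprod C X Y" "Cod C (l X Y) = X"
    "l X Y \<cdot> inl C X Y = Ident C X" "l X Y \<cdot> inr C X Y = zero_arr C Y X"
    if "X \<in> Obj C" "Y \<in> Obj C" for X Y
    unfolding l_def using that copair_simps[of "Ident C X" "zero_arr C Y X" X Y] by simp_all
  have 1: "l A A \<cdot> coprod_map C x y = x \<cdot> l X Y"
  proof (rule coproduct_joint_epic[of _ X Y])
    show "(l A A \<cdot> coprod_map C x y) \<cdot> inl C X Y = (x \<cdot> l X Y) \<cdot> inl C X Y"
      using reassoc[OF l(4)[OF obj(3,3)], of x] c(2) cA l(1-4)[OF obj(1,2)] l(1-3)[OF obj(3,3)] obj x by simp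
    show "(l A A \<cdot> coprod_map C x y) \<cdot> inr C X Y = (x \<cdot> l X Y) \<cdot> inr C X Y"
      using reassoc[OF l(5)[OF obj(3,3)], of y] c(3) cA l(1-3,5)[OF obj(1,2)] l(1-3)[OF obj(3,3)] obj x y by simp
  qed (use cA l(1-3)[OF obj(1,2)] l(1-3)[OF obj(3,3)] obj x in simp_all)
  have 2: "retr C A A \<cdot> coprod_map C x y = y \<cdot> retr C X Y"
  proof (rule coproduct_joint_epic[of _ X Y])
    show "(retr C A A \<cdot> coprod_map C x y) \<cdot> inl C X Y = (y \<cdot> retr C X Y) \<cdot> inl C X Y"
      using reassoc[OF retr_simps(4)[OF obj(3,3)], of x] c(2) cA obj x y by simp
    show "(retr C A A \<cdot> coprod_map C x y) \<cdot> inr C X Y = (y \<cdot> retr C X Y) \<cdot> inr C X Y"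
      using reassoc[OF retr_simps(5)[OF obj(3,3)], of y] c(3) cA obj x y by simp
  qed (use cA obj y in simp_all)
  define d where "d = copair C (Ident C A) (Ident C A)"
  have d: "d \<in> Arr C" "Dom C d = coprod C A A" "Cod C d = A" "d \<cdot> inl C A A = Ident C A" "d \<cdot> inr C A A = Ident C A"
    unfolding d_def using obj copair_simps[of "Ident C A" "Ident C A" A A] by simp_all
  have 3: "d \<cdot> coprod_map C x y = copair C x y"
  proof (rule coproduct_joint_epic[of _ X Y])
    show "(d \<cdot> coprod_map C x y) \<cdot> inl C X Y = copair C x y \<cdot> inl C X Y"
      using reassoc[OF d(4), of x] c(2) cA d(1-3) obj x xy by simp
    show "(d \<cdot> coprod_map C x y) \<cdot> inr C X Y = copair C x y \<cdot> inr C X Y"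
      using reassoc[OF d(5), of y] c(3) cA d(1-3) obj y xy by simp
  qed (use cA obj d xy in simp_all)
  define t where "t = coprod_map C x y \<cdot> cosmash_incl C X Y"
  have t: "t \<in> Arr C" "Dom C t = Dom C (cosmash_incl C X Y)" "Cod C t = coprod C A A"
    unfolding t_def using cA i(2,3) by simp_all
  have "l A A \<cdot> t = zero_arr C (Dom C t) A"
    using reassoc[OF 1, of "cosmash_incl C X Y"] i(2-4) cA l(1-3)[OF obj(1,2)] l(1-3)[OF obj(3,3)] obj x t(2)
    unfolding t_def l_def by simp
  moreover have "retr C A A \<cdot> t = zero_arr C (Dom C t) A"
    using reassoc[OF 2, of "cosmash_incl C X Y"] i(2,3,5) cA obj y t(2) unfolding t_def by simp
  ultimately have "factors_through C t (cosmash_incl C A A)"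
    using j(6)[OF t(1,3)] unfolding l_def by simp
  then obtain u where u: "u \<in> Arr C" "Dom C u = Dom C t" "Cod C u = Dom C (cosmash_incl C A A)"
    "cosmash_incl C A A \<cdot> u = t" by (rule factors_throughE)
  have "cosmash_map C x y = u"
    unfolding cosmash_map_def using x y factorization_eq[OF j(1) u(4) u(1) u(3)] by (simp add: t_def)
  then have "conj_action C A \<cdot> cosmash_map C x y = d \<cdot> t"
    unfolding conj_action_def using u d j(2,3) by (simp add: d_def)
  also have "\<dots> = copair C x y \<cdot> cosmash_incl C X Y"
    unfolding t_def using reassoc[OF 3, of "cosmash_incl C X Y"] cA d i(2,3) by simp
  finally show ?thesis .
qed

text \<open>The kernel of \<open>r\<^sub>Y\<close> is generated by \<open>(X|Y)\<close>, the kernel of its retraction onto \<open>X\<close>, and by \<open>X\<close>,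
  the section of that retraction.\<close>

lemma normalizes_iff_kernel_retr:
  assumes x: "is_subobject C x X A" and y: "y \<in> hom C Y A" and K: "is_kernel C (retr C X Y) k"
  shows "normalizes C y x \<longleftrightarrow> factors_through C (copair C x y \<cdot> k) x"
proof -
  have xm: "is_monic C x" and xA: "x \<in> Arr C" "Dom C x = X" "Cod C x = A"
    using x unfolding is_subobject_def by simp_all
  have obj: "X \<in> Obj C" "Y \<in> Obj C" "A \<in> Obj C" using xA y by auto
  note i = cosmash_incl[OF obj(1,2)]
  note k = kernelD[OF K]
  have kC: "Cod C k = coprod C X Y" "retr C X Y \<cdot> k = zero_arr C (Dom C k) Y" using k obj by simp_all
  have xy: "copair C x y \<in> Arr C" "Dom C (copair C x y) = coprod C X Y" "Cod C (copair C x y) = A"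
    "copair C x y \<cdot> inl C X Y = x"
    using xA y copair_simps[of x y X Y] by simp_all
  have nrm: "normalizes C y x \<longleftrightarrow> factors_through C (copair C x y \<cdot> cosmash_incl C X Y) x"
    unfolding normalizes_def using conj_action_cosmash_map[of x X A y Y] xA y by simp
  obtain l where l: "l \<in> Arr C" "Dom C l = Dom C (cosmash_incl C X Y)" "Cod C l = Dom C k"
    "k \<cdot> l = cosmash_incl C X Y"
    by (rule kernel_lift[OF K, of "cosmash_incl C X Y"]) (use i obj in simp_all)
  obtain s where s: "s \<in> Arr C" "Dom C s = X" "Cod C s = Dom C k" "k \<cdot> s = inl C X Y"
    by (rule kernel_lift[OF K, of "inl C X Y"]) (use obj in simp_all)
  define r where "r = copair C (Ident C X) (zero_arr C Y X)"
  have r: "r \<in> Arr C" "Dom C r = coprod C X Y" "Cod C r = X" "r \<cdot> inl C X Y = Ident C X"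
    unfolding r_def using obj copair_simps[of "Ident C X" "zero_arr C Y X" X Y] by simp_all
  have ri: "r \<cdot> cosmash_incl C X Y = zero_arr C (Dom C (cosmash_incl C X Y)) X"
    unfolding r_def by (fact i(4))
  have pt: "is_point C (r \<cdot> k) s" using r s k(2) kC unfolding is_point_def by simp
  \<comment> \<open>Inside the kernel of \<open>retr C X Y\<close>, being killed by the other
    retraction \<open>r\<close> is exactly membership in \<open>(X|Y)\<close>.\<close>
  have L: "is_kernel C (r \<cdot> k) l"
  proof (rule is_kernelI)
    show "is_monic C l" using i(1) l k(2) by (intro monic_factor[of k l]) simp_all
    show "(r \<cdot> k) \<cdot> l = zero_arr C (Dom C l) (Cod C (r \<cdot> k))" using ri l r k(2) kC by simp
    fix h assume h: "h \<in> Arr C" "Cod C h = Dom C (r \<cdot> k)" "(r \<cdot> k) \<cdot> h = zero_arr C (Dom C h) (Cod C (r \<cdot> k))"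
    have hC: "Cod C h = Dom C k" using h r k(2) kC by simp
    have "factors_through C (k \<cdot> h) (cosmash_incl C X Y)"
    proof (rule i(6))
      show "copair C (Ident C X) (zero_arr C Y X) \<cdot> (k \<cdot> h) = zero_arr C (Dom C (k \<cdot> h)) X"
        using h hC r k(2) kC(1) unfolding r_def[symmetric] by simp
      show "retr C X Y \<cdot> (k \<cdot> h) = zero_arr C (Dom C (k \<cdot> h)) Y"
        using reassoc[OF kC(2), of h] h(1) hC k(2) kC(1) obj by simp
    qed (use h(1) hC k(2) kC in simp_all)
    then obtain w where w: "w \<in> Arr C" "Dom C w = Dom C (k \<cdot> h)" "Cod C w = Dom C (cosmash_incl C X Y)"
      "cosmash_incl C X Y \<cdot> w = k \<cdot> h" by (rule factors_throughE)
    have wD: "Dom C w = Dom C h" using w(2) h(1) hC k(2) by simp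
    have "k \<cdot> (l \<cdot> w) = k \<cdot> h" using reassoc[OF l(4), of w] w l k(2) by simp
    then have "l \<cdot> w = h" using w(1,3) wD l(1-3) h(1) hC k(2)
      by - (rule monicD[OF kernel_monic[OF K]], simp_all)
    then show "factors_through C h l" by (rule factors_throughI) (use w l in simp_all)
  qed (use l r k(2) kC in simp_all)
  show ?thesis
  proof
    assume "normalizes C y x"
    then have il: "factors_through C ((copair C x y \<cdot> k) \<cdot> l) x" using nrm l k(2) kC xy by simp
    \<comment> \<open>On the section the factorization through \<open>x\<close> is automatic, so the
      condition on \<open>(X|Y)\<close> is the only one left.\<close>
    have "(copair C x y \<cdot> k) \<cdot> s = x" using s k(2) kC xy by simp
    then have xs: "factors_through C ((copair C x y \<cdot> k) \<cdot> s) x"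
      using xA obj by (intro factors_throughI[of x "Ident C X"]) simp_all
    show "factors_through C (copair C x y \<cdot> k) x"
      by (rule factors_through_split[OF pt L xm _ _ _ xs il]) (use k(2) kC xy r xA in simp_all)
  next
    assume "factors_through C (copair C x y \<cdot> k) x"
    then have "factors_through C ((copair C x y \<cdot> k) \<cdot> l) x"
      by (rule factors_through_comp) (use xA l k(2) kC xy in simp_all)
    then show "normalizes C y x" using nrm l k(2) kC xy by simp
  qed
qed

section \<open>Normalization and properness in the join\<close>

lemma join_factorization:
  assumes x: "x \<in> hom C X A" and y: "y \<in> hom C Y A"
  shows "regular_epi C (join_epi C x y)" "join_epi C x y \<in> hom C (coprod C X Y) (join_obj C x y)"
    "is_monic C (join_incl C x y)" "join_incl C x y \<in> hom C (join_obj C x y) A"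
    "join_incl C x y \<cdot> join_epi C x y = copair C x y"
    "factorization C x (join_incl C x y) = join_epi C x y \<cdot> inl C X Y"
    "join_incl C x y \<cdot> (join_epi C x y \<cdot> inl C X Y) = x"
    "join_incl C x y \<cdot> (join_epi C x y \<cdot> inr C X Y) = y"
proof -
  have obj: "X \<in> Obj C" "Y \<in> Obj C" using x y by auto
  have xy: "copair C x y \<in> Arr C" "Dom C (copair C x y) = coprod C X Y" "Cod C (copair C x y) = A"
    "copair C x y \<cdot> inl C X Y = x" "copair C x y \<cdot> inr C X Y = y"
    using x y copair_simps[of x y X Y] by simp_all
  note j = image_factorizationD[OF join_image_factorization[OF xy(1)]]
  show "regular_epi C (join_epi C x y)" "join_epi C x y \<in> hom C (coprod C X Y) (join_obj C x y)"
    "is_monic C (join_incl C x y)" "join_incl C x y \<in> hom C (join_obj C x y) A"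
    "join_incl C x y \<cdot> join_epi C x y = copair C x y"
    using j xy unfolding join_obj_def by simp_all
  show *: "join_incl C x y \<cdot> (join_epi C x y \<cdot> inl C X Y) = x"
    "join_incl C x y \<cdot> (join_epi C x y \<cdot> inr C X Y) = y"
    using reassoc[OF j(6), of "inl C X Y"] reassoc[OF j(6), of "inr C X Y"] j(3-5,7,8) xy obj by simp_all
  show "factorization C x (join_incl C x y) = join_epi C x y \<cdot> inl C X Y"
    using j xy obj by (intro factorization_eq[OF j(2) *(1)]) simp_all
qed

lemma normalizes_iff_proper_in_join:
  assumes x: "is_subobject C x X A" and y: "y \<in> hom C Y A"
  shows "normalizes C y x \<longleftrightarrow> is_proper C (factorization C x (join_incl C x y))"
proof -
  have xm: "is_monic C x" and xh: "x \<in> hom C X A" and xA: "x \<in> Arr C" "Dom C x = X" "Cod C x = A"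
    using x unfolding is_subobject_def by simp_all
  have obj: "X \<in> Obj C" "Y \<in> Obj C" "A \<in> Obj C" using xA y by auto
  define e where "e = join_epi C x y"
  define m where "m = join_incl C x y"
  define x' where "x' = e \<cdot> inl C X Y"
  note jf = join_factorization[OF xh y, folded e_def m_def]
  have e: "e \<in> Arr C" "Dom C e = coprod C X Y" "Cod C e = Dom C m" and m: "m \<in> Arr C" "Cod C m = A"
    using jf(2,4) by simp_all
  have x': "x' \<in> Arr C" "Dom C x' = X" "Cod C x' = Dom C m" "m \<cdot> x' = x"
    unfolding x'_def using e obj jf(7) by simp_all
  have x'm: "is_monic C x'" using xm x' m by (intro monic_factor[of m x']) simp_all
  obtain k where K: "is_kernel C (retr C X Y) k" using kernel_exists[of "retr C X Y"] obj by auto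
  note k = kernelD[OF K]
  have kC: "Cod C k = coprod C X Y" "retr C X Y \<cdot> k = zero_arr C (Dom C k) Y" using k obj by simp_all
  have mek: "copair C x y \<cdot> k = m \<cdot> (e \<cdot> k)" using reassoc[OF jf(5), of k] e m k(2) kC(1) by simp
  have "is_proper C x'" if nrm: "normalizes C y x"
  proof -
    obtain u where u: "u \<in> Arr C" "Dom C u = Dom C (copair C x y \<cdot> k)" "Cod C u = X" "x \<cdot> u = m \<cdot> (e \<cdot> k)"
      using nrm xA unfolding normalizes_iff_kernel_retr[OF x y K] mek by (auto elim: factors_throughE)
    have uD: "Dom C u = Dom C k" using u(2) e m k(2) kC(1) unfolding mek by simp
    have "m \<cdot> (x' \<cdot> u) = m \<cdot> (e \<cdot> k)" using reassoc[OF x'(4), of u] u(1,3,4) x'(1-3) m by simp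
    then have xu: "x' \<cdot> u = e \<cdot> k"
      using uD u(1,3) x'(1-3) m e k(2) kC(1) by - (rule monicD[OF jf(3)], simp_all)
    \<comment> \<open>The injection of \<open>X\<close> lies in the kernel of
      \<open>retr C X Y\<close>. It provides a section of \<open>u\<close>, so \<open>u\<close> is a
      regular epimorphism and \<open>x' \<cdot> u\<close> is the image factorization of
      \<open>e \<cdot> k\<close>.\<close>
    obtain s where s: "s \<in> Arr C" "Dom C s = X" "Cod C s = Dom C k" "k \<cdot> s = inl C X Y"
      by (rule kernel_lift[OF K, of "inl C X Y"]) (use obj in simp_all)
    have "x' \<cdot> (u \<cdot> s) = x' \<cdot> Ident C X"
      using reassoc[OF xu, of s] uD u(1,3) x'(1-3) s e k(2) kC(1) unfolding x'_def by simp
    then have "u \<cdot> s = Ident C X"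
      using uD u(1,3) x'(1-3) s obj by - (rule monicD[OF x'm], simp_all)
    then have "regular_epi C u" using uD u s by (intro split_epi_regular[of u "Dom C k" X s]) simp_all
    then have "is_image_factorization C (e \<cdot> k) u x'"
      unfolding is_image_factorization_def using x'm x' u(3) xu by simp
    then show ?thesis using obj e by (intro regular_image_proper[OF K jf(1)]) simp_all
  qed
  moreover have "normalizes C y x" if px: "is_proper C x'"
  proof -
    obtain f where F: "is_kernel C f x'" using px unfolding is_proper_def by blast
    note f = kernelD[OF F]
    have fD: "Dom C f = Dom C m" using f x' by simp
    define v where "v = f \<cdot> (e \<cdot> inr C X Y)"
    have v: "v \<in> Arr C" "Dom C v = Y" "Cod C v = Cod C f" unfolding v_def using f(1) fD e obj by simp_all
    \<comment> \<open>On \<open>X\<close> both sides vanish because \<open>x'\<close> is the kernel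
      of \<open>f\<close>; on \<open>Y\<close> they agree by the choice of \<open>v\<close>. Hence
      \<open>f \<cdot> e\<close> kills \<open>k\<close>, and \<open>e \<cdot> k\<close> lands in
      \<open>X\<close>.\<close>
    have fe: "f \<cdot> e = v \<cdot> retr C X Y"
    proof (rule coproduct_joint_epic[of _ X Y])
      show "(f \<cdot> e) \<cdot> inl C X Y = (v \<cdot> retr C X Y) \<cdot> inl C X Y"
        using f(1,4) fD x'(2) e v obj unfolding x'_def by simp
      show "(f \<cdot> e) \<cdot> inr C X Y = (v \<cdot> retr C X Y) \<cdot> inr C X Y"
        using f(1) fD e v obj unfolding v_def by simp
    qed (use f(1) fD e v obj in simp_all)
    have "f \<cdot> (e \<cdot> k) = zero_arr C (Dom C (e \<cdot> k)) (Cod C f)"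
      using reassoc[OF fe, of k] f(1) fD e v obj k(2) kC by simp
    then obtain u where u: "u \<in> Arr C" "Cod C u = Dom C x'" "x' \<cdot> u = e \<cdot> k"
      by (rule kernel_lift[OF F, rotated 2]) (use e k(2) kC(1) fD in simp_all)
    have "x \<cdot> u = m \<cdot> (e \<cdot> k)" using reassoc[OF x'(4), of u] u x'(1-3) m by simp
    then have "factors_through C (copair C x y \<cdot> k) x"
      unfolding mek by (rule factors_throughI) (use u x' xA in simp_all)
    then show ?thesis using normalizes_iff_kernel_retr[OF x y K] by simp
  qed
  ultimately show ?thesis using jf(6) unfolding x'_def m_def by auto
qed

section \<open>The short exact sequence\<close>

lemma cokernel_comp_iso:
  assumes F: "is_cokernel C i f" and a: "a \<in> hom C (Cod C f) Q" and b: "b \<in> hom C Q (Cod C f)"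
    and ab: "b \<cdot> a = Ident C (Cod C f)" "a \<cdot> b = Ident C Q"
  shows "is_cokernel C i (a \<cdot> f)"
proof (rule is_cokernelI)
  note f = cokernelD[OF F]
  show "i \<in> Arr C" "a \<cdot> f \<in> Arr C" "Dom C (a \<cdot> f) = Cod C i" using f a by simp_all
  show "(a \<cdot> f) \<cdot> i = zero_arr C (Dom C i) (Cod C (a \<cdot> f))" using f a by simp
  fix h assume h: "h \<in> Arr C" "Dom C h = Cod C i" "h \<cdot> i = zero_arr C (Dom C i) (Cod C h)"
  obtain u where u: "u \<in> Arr C" "Dom C u = Cod C f" "Cod C u = Cod C h" "u \<cdot> f = h"
    by (rule cokernel_lift[OF F h])
  have "(u \<cdot> b) \<cdot> (a \<cdot> f) = h" using reassoc[OF ab(1), of f] u a b f by simp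
  then show "\<exists>w \<in> hom C (Cod C (a \<cdot> f)) (Cod C h). w \<cdot> (a \<cdot> f) = h"
    using u a b f by (intro bexI[of _ "u \<cdot> b"]) simp_all
next
  note f = cokernelD[OF F]
  fix u v assume "u \<in> Arr C" "v \<in> Arr C" "Dom C u = Cod C (a \<cdot> f)" "Dom C v = Cod C (a \<cdot> f)"
    and eq: "u \<cdot> (a \<cdot> f) = v \<cdot> (a \<cdot> f)"
  then have uv: "u \<in> Arr C" "v \<in> Arr C" "Dom C u = Q" "Dom C v = Q" using a f by simp_all
  have "u \<cdot> a = v \<cdot> a" using eq uv a f by - (rule cokernel_cancel[OF F], simp_all)
  then have "(u \<cdot> a) \<cdot> b = (v \<cdot> a) \<cdot> b" by simp
  then show "u = v" using uv a b ab by simp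
qed

lemma proper_in_join_short_exact:
  assumes x: "is_subobject C x X A" and y: "y \<in> hom C Y A"
    and proper: "is_proper C (factorization C x (join_incl C x y))"
  shows "is_proper C (meet_incl C x y)"
    and "\<exists>u \<in> hom C (join_obj C x y) (Cod C (quot_proj C x y)).
      u \<cdot> join_epi C x y = quot_proj C x y \<cdot> retr C X Y \<and>
      short_exact C (factorization C x (join_incl C x y)) u"
proof -
  have xm: "is_monic C x" and xh: "x \<in> hom C X A" and xA: "x \<in> Arr C" "Dom C x = X" "Cod C x = A"
    using x unfolding is_subobject_def by simp_all
  have yA: "y \<in> Arr C" "Dom C y = Y" "Cod C y = A" using y by simp_all
  have obj: "X \<in> Obj C" "Y \<in> Obj C" "A \<in> Obj C" using xA y by auto
  define e where "e = join_epi C x y"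
  define m where "m = join_incl C x y"
  define J where "J = join_obj C x y"
  define i where "i = meet_incl C x y"
  define q where "q = quot_proj C x y"
  define x' where "x' = e \<cdot> inl C X Y"
  define y' where "y' = e \<cdot> inr C X Y"
  note jf = join_factorization[OF xh y, folded e_def m_def J_def]
  have e: "e \<in> Arr C" "Dom C e = coprod C X Y" "Cod C e = J" and m: "m \<in> Arr C" "Dom C m = J" "Cod C m = A"
    using jf(2,4) by simp_all
  have x': "x' \<in> Arr C" "Dom C x' = X" "Cod C x' = J" "m \<cdot> x' = x"
    unfolding x'_def using e obj jf(7) by simp_all
  have y': "y' \<in> Arr C" "Dom C y' = Y" "Cod C y' = J" "m \<cdot> y' = y"
    unfolding y'_def using e obj jf(8) by simp_all
  have x'm: "is_monic C x'" using xm x' m by (intro monic_factor[of m x']) simp_all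
  obtain f0 where F0: "is_kernel C f0 x'"
    using proper jf(6) unfolding is_proper_def m_def[symmetric] x'_def by auto
  note f0 = kernelD[OF F0]
  \<comment> \<open>The arrow \<open>f0\<close> has the right kernel but may fail to be a cokernel.
    It is replaced by the cokernel \<open>f\<close> of \<open>x'\<close>; since \<open>f0\<close>
    factors through \<open>f\<close>, the kernel is still \<open>x'\<close>.\<close>
  obtain f where F: "is_cokernel C x' f" using cokernel_exists[OF x'(1)] .
  note f = cokernelD[OF F]
  have fD: "f \<in> Arr C" "Dom C f = J" "f \<cdot> x' = zero_arr C X (Cod C f)" using f x' by simp_all
  obtain v0 where v0: "v0 \<in> Arr C" "Dom C v0 = Cod C f" "Cod C v0 = Cod C f0" "v0 \<cdot> f = f0"
    by (rule cokernel_lift[OF F, of f0]) (use f0 in simp_all)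
  have FK: "is_kernel C f x'"
  proof (rule is_kernelI[OF _ x'm])
    fix h assume h: "h \<in> Arr C" "Cod C h = Dom C f" "f \<cdot> h = zero_arr C (Dom C h) (Cod C f)"
    have "f0 \<cdot> h = zero_arr C (Dom C h) (Cod C f0)" using reassoc[OF v0(4), of h] v0(1-3) fD h by simp
    then obtain u where "u \<in> Arr C" "Cod C u = Dom C x'" "x' \<cdot> u = h"
      by (rule kernel_lift[OF F0, rotated 2]) (use h f0 fD x' in simp_all)
    then show "factors_through C h x'" using x' by (intro factors_throughI) simp_all
  qed (use fD x' in simp_all)
  define g where "g = f \<cdot> y'"
  have g: "g \<in> Arr C" "Dom C g = Y" "Cod C g = Cod C f" unfolding g_def using fD y' by simp_all
  have fe: "f \<cdot> e = g \<cdot> retr C X Y"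
  proof (rule coproduct_joint_epic[of _ X Y])
    show "(f \<cdot> e) \<cdot> inl C X Y = (g \<cdot> retr C X Y) \<cdot> inl C X Y"
      using fD e g obj unfolding x'_def by simp
    show "(f \<cdot> e) \<cdot> inr C X Y = (g \<cdot> retr C X Y) \<cdot> inr C X Y"
      using fD(1,2) e y' obj unfolding g_def y'_def by simp
  qed (use fD(1,2) e g obj in simp_all)
  obtain p where pb: "is_pullback C x y p i" using meet_is_pullback[of x y] xA yA unfolding i_def by auto
  note P = pullbackD[OF pb]
  have i: "i \<in> Arr C" "Cod C i = Y" "Dom C i = Dom C p" and p: "p \<in> Arr C" "Cod C p = X"
    using P xA yA by simp_all
  \<comment> \<open>An arrow into \<open>Y\<close> is killed by \<open>g = f \<cdot> y'\<close>
    exactly when its image in the join factors through \<open>x'\<close>, that is, when it lies in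
    the intersection.\<close>
  have I: "is_kernel C g i"
  proof (rule is_kernelI[OF g(1)])
    show "is_monic C i"
    proof (rule is_monicI[OF i(1)])
      fix u v assume uv: "u \<in> Arr C" "v \<in> Arr C" "Dom C u = Dom C v" "Cod C u = Dom C i" "Cod C v = Dom C i"
        "i \<cdot> u = i \<cdot> v"
      have "x \<cdot> (p \<cdot> u) = y \<cdot> (i \<cdot> u)" using reassoc[OF P(9), of u] uv(1-5) p i xA yA by simp
      also have "\<dots> = x \<cdot> (p \<cdot> v)" using reassoc[OF P(9), of v] uv p i xA yA by simp
      finally have "p \<cdot> u = p \<cdot> v" using uv(1-5) p i xA by - (rule monicD[OF xm], simp_all)
      then show "u = v" using uv i by - (rule pullback_joint_monic[OF pb], simp_all)
    qed
    have "m \<cdot> (y' \<cdot> i) = m \<cdot> (x' \<cdot> p)"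
      using reassoc[OF x'(4), of p] reassoc[OF y'(4), of i] P(9) x'(1-3) y'(1-3) i p m by simp
    then have "y' \<cdot> i = x' \<cdot> p" using x'(1-3) y'(1-3) i p m by - (rule monicD[OF jf(3)], simp_all)
    then show "g \<cdot> i = zero_arr C (Dom C i) (Cod C g)"
      using reassoc[OF fD(3), of p] fD(1,2) x'(1-3) y'(1-3) i p unfolding g_def by simp
    fix h assume h: "h \<in> Arr C" "Cod C h = Dom C g" "g \<cdot> h = zero_arr C (Dom C h) (Cod C g)"
    have "f \<cdot> (y' \<cdot> h) = zero_arr C (Dom C (y' \<cdot> h)) (Cod C f)"
      using h g(2,3) fD(1,2) y'(1-3) unfolding g_def by simp
    then obtain u where u: "u \<in> Arr C" "Dom C u = Dom C (y' \<cdot> h)" "Cod C u = Dom C x'" "x' \<cdot> u = y' \<cdot> h"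
      by (rule kernel_lift[OF FK, rotated 2]) (use h g(2) y'(1-3) fD in simp_all)
    have "x \<cdot> u = y \<cdot> h"
      using reassoc[OF x'(4), of u] reassoc[OF y'(4), of h] u h(1,2) g(2) x'(1-3) y'(1-3) m by simp
    then obtain w where "w \<in> Arr C" "Cod C w = Dom C p" "i \<cdot> w = h"
      by (rule pullback_lift[OF pb]) (use u h(1,2) g(2) x'(1-3) y'(1-3) xA yA in simp_all)
    then show "factors_through C h i" using i by (intro factors_throughI) simp_all
  qed (use g i in simp_all)
  then show "is_proper C (meet_incl C x y)" unfolding is_proper_def i_def by blast
  have gi: "g \<cdot> i = zero_arr C (Dom C i) (Cod C g)" by (rule kernelD(4)[OF I])
  \<comment> \<open>Since \<open>g \<cdot> retr C X Y = f \<cdot> e\<close>, the retraction carries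
    the kernel of \<open>e\<close> into the intersection. Thus if \<open>h\<close> kills the
    intersection, \<open>h \<cdot> retr C X Y\<close> kills the kernel of \<open>e\<close> and
    descends to some \<open>w\<close> on the join; \<open>w\<close> kills \<open>x'\<close> and
    hence factors through \<open>f\<close>.\<close>
  have G: "is_cokernel C i g"
  proof (rule is_cokernelI[OF i(1) g(1) _ gi])
    fix h assume h: "h \<in> Arr C" "Dom C h = Cod C i" "h \<cdot> i = zero_arr C (Dom C i) (Cod C h)"
    obtain n where N: "is_kernel C e n" using kernel_exists[OF e(1)] .
    note n = kernelD[OF N]
    have "g \<cdot> (retr C X Y \<cdot> n) = zero_arr C (Dom C (retr C X Y \<cdot> n)) (Cod C g)"
      using reassoc[OF fe[symmetric], of n] n e fD(1,2) g obj by simp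
    then obtain v where v: "v \<in> Arr C" "Dom C v = Dom C (retr C X Y \<cdot> n)" "Cod C v = Dom C i"
      "i \<cdot> v = retr C X Y \<cdot> n"
      by (rule kernel_lift[OF I, rotated 2]) (use n e g obj in simp_all)
    have "(h \<cdot> retr C X Y) \<cdot> n = zero_arr C (Dom C n) (Cod C (h \<cdot> retr C X Y))"
      using reassoc[OF h(3), of v] v h(1,2) i n(2,3) e obj by simp
    then obtain w where w: "w \<in> Arr C" "Dom C w = Cod C e" "Cod C w = Cod C (h \<cdot> retr C X Y)"
      "w \<cdot> e = h \<cdot> retr C X Y"
      by (rule cokernel_lift[OF regular_epi_cokernel[OF jf(1) N], rotated 2]) (use n e h i obj in simp_all)
    have wD: "Dom C w = J" "Cod C w = Cod C h" using w(2,3) e h i obj by simp_all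
    have "w \<cdot> x' = zero_arr C (Dom C x') (Cod C w)"
      using reassoc[OF w(4), of "inl C X Y"] w(1) wD e h(1,2) i obj unfolding x'_def by simp
    then obtain t where t: "t \<in> Arr C" "Dom C t = Cod C f" "Cod C t = Cod C w" "t \<cdot> f = w"
      by (rule cokernel_lift[OF F, rotated 2]) (use w(1) wD x' in simp_all)
    have "t \<cdot> g = w \<cdot> y'" using reassoc[OF t(4), of y'] t fD(1,2) y'(1-3) unfolding g_def by simp
    also have "\<dots> = h"
      using reassoc[OF w(4), of "inr C X Y"] w(1) wD e h(1,2) i obj unfolding y'_def by simp
    finally show "\<exists>u \<in> hom C (Cod C g) (Cod C h). u \<cdot> g = h" using t g wD by auto
  next
    fix u v assume uv: "u \<in> Arr C" "v \<in> Arr C" "Dom C u = Cod C g" "Dom C v = Cod C g" "u \<cdot> g = v \<cdot> g"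
    \<comment> \<open>For uniqueness, precomposition with \<open>retr C X Y\<close> turns
      \<open>g\<close> into \<open>f \<cdot> e\<close>, and both \<open>e\<close> and
      \<open>f\<close> can be cancelled on the right.\<close>
    have "u \<cdot> (f \<cdot> e) = v \<cdot> (f \<cdot> e)"
      using reassoc[OF uv(5), of "retr C X Y"] uv(1-4) g obj unfolding fe by simp
    then have "u \<cdot> f = v \<cdot> f" using uv(1-4) g fD(1,2) e by - (rule regular_epi_cancel[OF jf(1)], simp_all)
    then show "u = v" using uv(1-4) g by - (rule cokernel_cancel[OF F], simp_all)
  qed (use g i in simp)
  have Q: "is_cokernel C i q" unfolding q_def quot_proj_def i_def[symmetric] by (rule coker_is_cokernel[OF i(1)])
  note q = cokernelD[OF Q]
  obtain a where a: "a \<in> Arr C" "Dom C a = Cod C g" "Cod C a = Cod C q" "a \<cdot> g = q"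
    by (rule cokernel_lift[OF G q(2,3,4)])
  obtain b where b: "b \<in> Arr C" "Dom C b = Cod C q" "Cod C b = Cod C g" "b \<cdot> q = g"
    by (rule cokernel_lift[OF Q g(1) _ gi]) (use g i in simp)
  \<comment> \<open>Both \<open>g\<close> and the chosen \<open>q\<close> are cokernels of
    \<open>i\<close>, so \<open>a\<close> and \<open>b\<close> are mutually inverse comparisons. The
    induced map on the join is therefore \<open>a \<cdot> f\<close>, which keeps the kernel and
    cokernel properties of \<open>f\<close>.\<close>
  have ba: "b \<cdot> a = Ident C (Cod C f)" using a b g q fD(1) by - (rule cokernel_cancel[OF G], simp_all)
  have ab: "a \<cdot> b = Ident C (Cod C q)" using a b g q by - (rule cokernel_cancel[OF Q], simp_all)
  have "is_cokernel C x' (a \<cdot> f)"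
    using a b g ba ab by (intro cokernel_comp_iso[OF F, of a "Cod C q" b]) simp_all
  moreover have "is_kernel C (a \<cdot> f) x'"
  proof (rule is_kernelI[OF _ x'm])
    fix h assume h: "h \<in> Arr C" "Cod C h = Dom C (a \<cdot> f)" "(a \<cdot> f) \<cdot> h = zero_arr C (Dom C h) (Cod C (a \<cdot> f))"
    have hC: "Cod C h = J" using h a g fD by simp
    have "b \<cdot> ((a \<cdot> f) \<cdot> h) = zero_arr C (Dom C h) (Cod C f)" unfolding h(3) using h(1) a b g fD by simp
    then have "f \<cdot> h = zero_arr C (Dom C h) (Cod C f)"
      using reassoc[OF ba, of "f \<cdot> h"] h(1) hC a(1-3) b(1-3) g fD(1,2) by simp
    then obtain u where "u \<in> Arr C" "Cod C u = Dom C x'" "x' \<cdot> u = h"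
      by (rule kernel_lift[OF FK, rotated 2]) (use h(1) hC fD in simp_all)
    then show "factors_through C h x'" using x' by (intro factors_throughI) simp_all
  qed (use a g fD x' obj in simp_all)
  ultimately have "short_exact C x' (a \<cdot> f)" unfolding short_exact_def by simp
  moreover have "(a \<cdot> f) \<cdot> e = q \<cdot> retr C X Y"
    using reassoc[OF a(4), of "retr C X Y"] fe a(1-3) g fD(1,2) e obj by simp
  ultimately show "\<exists>u \<in> hom C (join_obj C x y) (Cod C (quot_proj C x y)).
      u \<cdot> join_epi C x y = quot_proj C x y \<cdot> retr C X Y \<and>
      short_exact C (factorization C x (join_incl C x y)) u"
    using a g fD jf(6) unfolding e_def[symmetric] q_def[symmetric] J_def[symmetric] m_def[symmetric] x'_def[symmetric]
    by (intro bexI[of _ "a \<cdot> f"]) simp_all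
qed

end

theorem theorem23:
  fixes C :: "('o, 'm) cat" and x y :: 'm and X Y A :: 'o
  assumes "semi_abelian C"
    and "is_subobject C x X A"
    and "is_subobject C y Y A"
  shows
    "(normalizes C y x \<longleftrightarrow> is_proper C (factorization C x (join_incl C x y))) \<and>
     (normalizes C y x \<longleftrightarrow>
        is_proper C (meet_incl C x y) \<and>
        (\<exists>u \<in> hom C (join_obj C x y) (Cod C (quot_proj C x y)).
           u \<cdot>\<^bsub>C\<^esub> join_epi C x y = quot_proj C x y \<cdot>\<^bsub>C\<^esub> retr C X Y \<and>
           short_exact C (factorization C x (join_incl C x y)) u))"
proof -
  interpret semi_abelian C by fact
  have y: "y \<in> hom C Y A" using assms(3) unfolding is_subobject_def by simp
  note iff = normalizes_iff_proper_in_join[OF assms(2) y]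
  \<comment> \<open>This closes the cycle from (3) back to (2): the kernel half of short exactness
    already exhibits \<open>X\<close> as proper in the join.\<close>
  have "is_proper C x'" if "short_exact C x' u" for x' u
    using that unfolding short_exact_def is_proper_def by blast
  with iff proper_in_join_short_exact[OF assms(2) y] show ?thesis by metis
qed

end
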